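(* The Poincaré distance $\delta_\Delta$ of $\Delta_{\mathbb{H}}$ is invariant under the action of the group $\mathbb{M}$ of all Möbius transformations and of the map $q\mapsto\overline{q}$.
   Context: $\mathbb{H}\cong\mathbb{R}^4$ is the skew field of real quaternions and $\Delta_{\mathbb{H}}=\{q\in\mathbb{H}:|q|<1\}$. $\mathbb{M}$ is the group of all maps $q\mapsto(aq+b)(cq+d)^{-1}$ ($a,b,c,d\in\mathbb{H}$, $\begin{bmatrix} a & b\\ c & d\end{bmatrix}$ an invertible quaternionic matrix) which map $\Delta_{\mathbb{H}}$ onto itself. The cross-ratio is $\mathcal{CR}(q_1,q_2,q_3,q_4)=(q_1-q_3)(q_1-q_4)^{-1}(q_2-q_4)(q_2-q_3)^{-1}$. The non-Euclidean line through $q_1\ne q_2\in\Delta_{\mathbb{H}}$ is the diameter of $\Delta_{\mathbb{H}}$ containing them if $q_1,q_2$ are $\mathbb{R}$-linearly dependent, and otherwise the unique circle through $q_1,q_2$ that intersects $\partial\Delta_{\mathbb{H}}$ orthogonally; its two ends are its intersection points with $\partial\Delta_{\mathbb{H}}$. The Poincaré distance is $\delta_\Delta(q_1,q_2)=\frac12\log\big(\mathcal{CR}(q_1,q_2,q_3,q_4)\big)$, where $q_3,q_4$ are the ends of the non-Euclidean line through $q_1,q_2$, named so that $q_1,q_2,q_3,q_4$ are arranged cyclically on it (for example, $\delta_\Delta(0,t)=\frac12\log\mathcal{CR}(0,t,1,-1)$ for $0<t<1$); and $\delta_\Delta(q,q)=0$. *)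

theory Defs
  imports "HOL-Analysis.Analysis"
begin

codatatype quat = Quat (Qre: real) (Qi: real) (Qj: real) (Qk: real)

lemma quat_eqI [intro?]:
  "Qre x = Qre y \<Longrightarrow> Qi x = Qi y \<Longrightarrow> Qj x = Qj y \<Longrightarrow> Qk x = Qk y \<Longrightarrow> x = y"
  by (rule quat.expand) simp

lemma quat_eq_iff: "x = y \<longleftrightarrow> Qre x = Qre y \<and> Qi x = Qi y \<and> Qj x = Qj y \<and> Qk x = Qk y"
  by (auto intro: quat.expand)

instantiation quat :: real_vector
begin

primcorec zero_quat where
  "Qre 0 = 0" | "Qi 0 = 0" | "Qj 0 = 0" | "Qk 0 = 0"

primcorec plus_quat where
  "Qre (x + y) = Qre x + Qre y"
| "Qi (x + y) = Qi x + Qi y"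
| "Qj (x + y) = Qj x + Qj y"
| "Qk (x + y) = Qk x + Qk y"

primcorec uminus_quat where
  "Qre (- x) = - Qre x" | "Qi (- x) = - Qi x" | "Qj (- x) = - Qj x" | "Qk (- x) = - Qk x"

primcorec minus_quat where
  "Qre (x - y) = Qre x - Qre y"
| "Qi (x - y) = Qi x - Qi y"
| "Qj (x - y) = Qj x - Qj y"
| "Qk (x - y) = Qk x - Qk y"

primcorec scaleR_quat where
  "Qre (r *\<^sub>R x) = r * Qre x"
| "Qi (r *\<^sub>R x) = r * Qi x"
| "Qj (r *\<^sub>R x) = r * Qj x"
| "Qk (r *\<^sub>R x) = r * Qk x"

instance
  by standard (simp_all add: quat_eq_iff algebra_simps)

end

instantiation quat :: real_inner
begin

definition inner_quat :: "quat \<Rightarrow> quat \<Rightarrow> real" where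
  "inner x y = Qre x * Qre y + Qi x * Qi y + Qj x * Qj y + Qk x * Qk y"

definition norm_quat :: "quat \<Rightarrow> real" where
  "norm x = sqrt ((Qre x)\<^sup>2 + (Qi x)\<^sup>2 + (Qj x)\<^sup>2 + (Qk x)\<^sup>2)"

definition "sgn (x::quat) = x /\<^sub>R norm x"

definition "dist (x::quat) y = norm (x - y)"

definition uniformity_quat :: "(quat \<times> quat) filter" where
  "uniformity_quat = (INF e\<in>{0 <..}. principal {(x, y). dist x y < e})"

definition open_quat :: "quat set \<Rightarrow> bool" where
  "open_quat U \<longleftrightarrow> (\<forall>x\<in>U. eventually (\<lambda>(x', y). x' = x \<longrightarrow> y \<in> U) uniformity)"

instance
proof
  fix x y z :: quat and r :: real and U :: "quat set"
  show "inner x x = 0 \<longleftrightarrow> x = 0"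
  proof
    assume "inner x x = 0"
    then have "(Qre x)\<^sup>2 + (Qi x)\<^sup>2 + (Qj x)\<^sup>2 + (Qk x)\<^sup>2 = 0"
      by (simp add: inner_quat_def power2_eq_square)
    then have "(Qre x)\<^sup>2 = 0 \<and> (Qi x)\<^sup>2 = 0 \<and> (Qj x)\<^sup>2 = 0 \<and> (Qk x)\<^sup>2 = 0"
      using zero_le_power2[of "Qre x"] zero_le_power2[of "Qi x"]
        zero_le_power2[of "Qj x"] zero_le_power2[of "Qk x"] by linarith
    then show "x = 0" by (simp add: quat_eq_iff [of x])
  qed (simp add: inner_quat_def)
  show "inner x y = inner y x" "inner (x + y) z = inner x z + inner y z"
    "inner (r *\<^sub>R x) y = r * inner x y"
    by (simp_all add: inner_quat_def algebra_simps)
  show "0 \<le> inner x x"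
    by (simp add: inner_quat_def)
  show "norm x = sqrt (inner x x)"
    by (simp add: inner_quat_def norm_quat_def power2_eq_square)
qed (rule sgn_quat_def dist_quat_def uniformity_quat_def open_quat_def)+

end

instantiation quat :: euclidean_space
begin

definition Basis_quat :: "quat set" where
  "Basis = {Quat 1 0 0 0, Quat 0 1 0 0, Quat 0 0 1 0, Quat 0 0 0 1}"

instance
proof
  fix u v x :: quat
  show "(Basis :: quat set) \<noteq> {}" "finite (Basis :: quat set)"
    by (simp_all add: Basis_quat_def)
  show "u \<in> Basis \<Longrightarrow> v \<in> Basis \<Longrightarrow> inner u v = (if u = v then 1 else 0)"
    unfolding Basis_quat_def inner_quat_def by (elim insertE emptyE; simp)
  show "(\<forall>u\<in>Basis. inner x u = 0) \<longleftrightarrow> x = 0"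
    unfolding Basis_quat_def inner_quat_def by (simp add: quat_eq_iff [of x])
qed

end

instantiation quat :: real_normed_div_algebra
begin

primcorec one_quat where
  "Qre 1 = 1" | "Qi 1 = 0" | "Qj 1 = 0" | "Qk 1 = 0"

primcorec times_quat where
  "Qre (x * y) = Qre x * Qre y - Qi x * Qi y - Qj x * Qj y - Qk x * Qk y"
| "Qi (x * y) = Qre x * Qi y + Qi x * Qre y + Qj x * Qk y - Qk x * Qj y"
| "Qj (x * y) = Qre x * Qj y - Qi x * Qk y + Qj x * Qre y + Qk x * Qi y"
| "Qk (x * y) = Qre x * Qk y + Qi x * Qj y - Qj x * Qi y + Qk x * Qre y"

definition inverse_quat :: "quat \<Rightarrow> quat" where
  "inverse x = Quat (Qre x) (- Qi x) (- Qj x) (- Qk x) /\<^sub>R (norm x)\<^sup>2"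

definition divide_quat :: "quat \<Rightarrow> quat \<Rightarrow> quat" where
  "divide_quat x y = x * inverse y"

instance
proof
  fix x y z :: quat and r :: real
  show "x * y * z = x * (y * z)" "(x + y) * z = x * z + y * z" "x * (y + z) = x * y + x * z"
    "1 * x = x" "x * 1 = x" "(0::quat) \<noteq> 1"
    "r *\<^sub>R x * y = r *\<^sub>R (x * y)" "x * r *\<^sub>R y = r *\<^sub>R (x * y)"
    by (simp_all add: quat_eq_iff algebra_simps)
  show "x div y = x * inverse y" by (simp add: divide_quat_def)
  show "inverse (0::quat) = 0" by (simp add: inverse_quat_def)
  show "norm (x * y) = norm x * norm y"
    unfolding norm_quat_def real_sqrt_mult [symmetric]
    by (rule arg_cong [where f = sqrt]) (simp add: power2_eq_square algebra_simps)
  let ?c = "Quat (Qre x) (- Qi x) (- Qj x) (- Qk x)"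
  assume "x \<noteq> 0"
  then have nz: "(norm x)\<^sup>2 \<noteq> 0" by simp
  have l: "(r *\<^sub>R y) * z = r *\<^sub>R (y * z)" and m: "y * (r *\<^sub>R z) = r *\<^sub>R (y * z)" for r and y z :: quat
    by (simp_all add: quat_eq_iff algebra_simps)
  have "?c * x = (norm x)\<^sup>2 *\<^sub>R 1" "x * ?c = (norm x)\<^sup>2 *\<^sub>R 1"
    by (simp_all add: quat_eq_iff norm_quat_def power2_eq_square)
  then show "inverse x * x = 1" "x * inverse x = 1"
    using nz by (simp_all add: inverse_quat_def l m)
qed

end

definition qconj :: "quat \<Rightarrow> quat" where
  "qconj x = Quat (Qre x) (- Qi x) (- Qj x) (- Qk x)"

abbreviation Delta :: "quat set"  (\<open>\<Delta>\<close>) where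
  "\<Delta> \<equiv> ball 0 1"

definition moebius :: "quat^2^2 \<Rightarrow> quat \<Rightarrow> quat" where
  "moebius A q = (A $ 1 $ 1 * q + A $ 1 $ 2) * inverse (A $ 2 $ 1 * q + A $ 2 $ 2)"

text \<open>
  Since \<open>inverse 0 = 0\<close>, \<open>moebius A\<close> has value \<open>0\<close> instead of \<open>\<infinity>\<close> at a pole. A transformation with a
  pole in \<open>\<Delta>\<close> does not map \<open>\<Delta>\<close> to itself, so poles in \<open>\<Delta>\<close> are excluded explicitly.
\<close>

definition Moebius_group :: "(quat \<Rightarrow> quat) set"  (\<open>\<bbbM>\<close>) where
  "\<bbbM> = {moebius A | A. invertible A \<and> (\<forall>q\<in>\<Delta>. A $ 2 $ 1 * q + A $ 2 $ 2 \<noteq> 0)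
                      \<and> moebius A ` \<Delta> = \<Delta>}"

definition circle_point :: "quat \<Rightarrow> real \<Rightarrow> quat \<Rightarrow> quat \<Rightarrow> real \<Rightarrow> quat" where
  "circle_point c r u v t = c + (r * cos t) *\<^sub>R u + (r * sin t) *\<^sub>R v"

definition circle_param :: "quat set \<Rightarrow> (real \<Rightarrow> quat) \<Rightarrow> bool" where
  "circle_param C \<gamma> \<longleftrightarrow>
     (\<exists>c r u v. r > 0 \<and> norm u = 1 \<and> norm v = 1 \<and> orthogonal u v \<and>
                \<gamma> = circle_point c r u v \<and> C = range \<gamma>)"

text \<open>
  The tangent space of the unit sphere at \<open>p\<close> is the orthogonal complement of \<open>p\<close>; a circle meets the
  sphere orthogonally at \<open>p\<close> if its tangent vector is orthogonal to that space.
\<close>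

definition circle_orthogonal_to_sphere :: "quat set \<Rightarrow> bool" where
  "circle_orthogonal_to_sphere C \<longleftrightarrow>
     C \<inter> sphere 0 1 \<noteq> {} \<and>
     (\<exists>\<gamma>. circle_param C \<gamma> \<and>
          (\<forall>t. \<gamma> t \<in> sphere 0 1 \<longrightarrow>
               (\<forall>w. orthogonal (\<gamma> t) w \<longrightarrow> orthogonal (vector_derivative \<gamma> (at t)) w)))"

definition is_diameter :: "quat set \<Rightarrow> bool" where
  "is_diameter D \<longleftrightarrow> (\<exists>p\<in>sphere 0 1. D = closed_segment (- p) p)"

definition noneuclidean_line :: "quat \<Rightarrow> quat \<Rightarrow> quat set" where
  "noneuclidean_line a b =
     (if dependent {a, b}
      then THE D. is_diameter D \<and> a \<in> D \<and> b \<in> D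
      else THE C. circle_orthogonal_to_sphere C \<and> a \<in> C \<and> b \<in> C)"

definition cross_ratio :: "quat \<Rightarrow> quat \<Rightarrow> quat \<Rightarrow> quat \<Rightarrow> quat" where
  "cross_ratio x1 x2 x3 x4 =
     (x1 - x3) * inverse (x1 - x4) * (x2 - x4) * inverse (x2 - x3)"

definition cyclic_order :: "real \<Rightarrow> real \<Rightarrow> real \<Rightarrow> real \<Rightarrow> bool" where
  "cyclic_order t1 t2 t3 t4 \<longleftrightarrow>
     t1 < t2 \<and> t2 < t3 \<and> t3 < t4 \<or> t2 < t3 \<and> t3 < t4 \<and> t4 < t1 \<or>
     t3 < t4 \<and> t4 < t1 \<and> t1 < t2 \<or> t4 < t1 \<and> t1 < t2 \<and> t2 < t3"

text \<open>
  A diameter is regarded as part of the Euclidean line extending it, closed up by \<open>\<infinity>\<close>. Both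
  orientations of a circle or line are admitted, through the choice of the parametrisation.
\<close>

definition cyclically_arranged :: "quat set \<Rightarrow> quat \<Rightarrow> quat \<Rightarrow> quat \<Rightarrow> quat \<Rightarrow> bool" where
  "cyclically_arranged L x1 x2 x3 x4 \<longleftrightarrow>
     {x1, x2, x3, x4} \<subseteq> L \<and>
     (\<exists>\<gamma> T. (circle_param L \<gamma> \<and> T = {0..<2 * pi} \<or>
             (\<exists>a u. u \<noteq> 0 \<and> \<gamma> = (\<lambda>t. a + t *\<^sub>R u) \<and> L \<subseteq> range \<gamma> \<and> T = UNIV)) \<and>
            (\<exists>t1\<in>T. \<exists>t2\<in>T. \<exists>t3\<in>T. \<exists>t4\<in>T. cyclic_order t1 t2 t3 t4 \<and>
                x1 = \<gamma> t1 \<and> x2 = \<gamma> t2 \<and> x3 = \<gamma> t3 \<and> x4 = \<gamma> t4))"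

text \<open>
  The cross-ratio of four points of a circle or line is real, and it is positive in the arrangement
  used here; \<open>r\<close> is this value, read as a real number so that the real logarithm applies.
\<close>

definition poincare_dist :: "quat \<Rightarrow> quat \<Rightarrow> real"  (\<open>\<delta>\<^sub>\<Delta>\<close>) where
  "poincare_dist a b =
     (if a = b then 0
      else THE d. \<exists>e1 e2 r. noneuclidean_line a b \<inter> sphere 0 1 = {e1, e2} \<and>
                   cyclically_arranged (noneuclidean_line a b) a b e1 e2 \<and>
                   cross_ratio a b e1 e2 = of_real r \<and> r > 0 \<and> d = 1 / 2 * ln r)"

end

theory Submission
  imports Defs
begin

text \<open>
  The distance has the closed form
  \<open>\<delta>\<^sub>\<Delta> a b = arcosh (1 + 2 h) / 2\<close> with \<open>h = |a - b|\<^sup>2 / ((1 - |a|\<^sup>2) (1 - |b|\<^sup>2))\<close>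
  (\<open>poincare_dist_eq_arcosh\<close>), and \<open>h\<close> is manifestly unchanged by conjugation. For a Moebius
  transformation one uses \<open>1 + h = |1 - a\<^sup>* b|\<^sup>2 / ((1 - |a|\<^sup>2) (1 - |b|\<^sup>2))\<close>, where \<open>a\<^sup>*\<close> is the conjugate
  of \<open>a\<close>, and the fact that its matrix preserves the form \<open>y\<^sub>1\<^sup>* y\<^sub>2 - x\<^sub>1\<^sup>* x\<^sub>2\<close> up to a positive
  factor (\<open>Moebius_group_form\<close>). This fact follows because \<open>|c q + d|\<^sup>2 - |a q + b|\<^sup>2\<close> is a
  quadratic polynomial in \<open>q\<close>, positive in the ball and, by injectivity of the transformation, zero
  on the sphere; hence it is a multiple of \<open>1 - |q|\<^sup>2\<close>.

  The closed form rests on two metric identities. The chords of four cyclically ordered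
  points of a circle or a line satisfy Ptolemy's identity. Consequently their cross-ratio \<open>r\<close> is real,
  greater than 1, and both \<open>r\<close> and \<open>r - 1\<close> are quotients of products of chord lengths
  (\<open>cyclically_arranged_imp_separated\<close>). This also decides which end of the line comes first: the
  other order inverts the cross-ratio. Secondly, a point \<open>x\<close> of a non-Euclidean line with ends
  \<open>e\<^sub>1, e\<^sub>2\<close> satisfies \<open>|x - e\<^sub>1| |x - e\<^sub>2| = (1 - |x|\<^sup>2) |e\<^sub>1 - e\<^sub>2| / 2\<close>. Together they give
  \<open>(r - 1)\<^sup>2 / r = 4 h\<close>, that is, \<open>cosh (ln r) = 1 + 2 h\<close> (\<open>poincare_dist_eqI\<close>).

  What remains is to determine the line. A circle orthogonal to the sphere lies in a plane through
  the origin, because its radius and its tangent at a common point span its plane and the tangent is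
  parallel to that point. In the plane, the centre is fixed by linear equations
  (\<open>circle_orthogonal_to_sphere_unique\<close>); an explicit trigonometric parametrisation shows that the
  circle exists and gives its ends and the order of its points.
\<close>

section \<open>Conjugation and the invariant of a pair of points\<close>

lemma qconj_sel [simp]:
  "Qre (qconj x) = Qre x" "Qi (qconj x) = - Qi x" "Qj (qconj x) = - Qj x" "Qk (qconj x) = - Qk x"
  by (simp_all add: qconj_def)

lemma of_real_quat_sel [simp]:
  "Qre (of_real r) = r" "Qi (of_real r) = 0" "Qj (of_real r) = 0" "Qk (of_real r) = 0"
  by (simp_all add: of_real_def)

lemma qconj_mult: "qconj (x * y) = qconj y * qconj x"
  by (simp add: quat_eq_iff algebra_simps)

lemma qconj_add: "qconj (x + y) = qconj x + qconj y"
  by (simp add: quat_eq_iff)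

lemma qconj_diff: "qconj (x - y) = qconj x - qconj y"
  by (simp add: quat_eq_iff)

lemma norm_qconj [simp]: "norm (qconj x) = norm x"
  by (simp add: norm_quat_def)

lemma qconj_mult_self: "qconj x * x = of_real ((norm x)\<^sup>2)"
  by (simp add: quat_eq_iff norm_quat_def power2_eq_square)

lemma inner_mult_left_quat: "inner (c * x) y = inner x (qconj c * (y :: quat))"
  by (simp add: inner_quat_def algebra_simps)

text \<open>
  The identity which turns invariance of a Hermitian form into invariance of a distance.
\<close>

lemma norm_one_minus_qconj_mult:
  "(norm (1 - qconj a * b))\<^sup>2 = (norm (a - b))\<^sup>2 + (1 - (norm a)\<^sup>2) * (1 - (norm b)\<^sup>2)"
  by (simp add: norm_quat_def) algebra

text \<open>
  This is \<open>sinh\<^sup>2 \<delta>\<close> for the distance \<open>\<delta>\<close> of \<open>a\<close> and \<open>b\<close>.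
\<close>

definition hyp_ratio :: "quat \<Rightarrow> quat \<Rightarrow> real" where
  "hyp_ratio a b = (norm (a - b))\<^sup>2 / ((1 - (norm a)\<^sup>2) * (1 - (norm b)\<^sup>2))"

section \<open>Moebius transformations of the ball preserve the invariant\<close>

text \<open>
  The equations for the coefficients say that the matrix preserves the form
  \<open>y\<^sub>1\<^sup>* y\<^sub>2 - x\<^sub>1\<^sup>* x\<^sub>2\<close> up to the factor \<open>\<kappa>\<close>. They are read off from the polynomial
  \<open>h q = |c q + d|\<^sup>2 - |a q + b|\<^sup>2\<close> once it is known to vanish on the sphere. By continuity \<open>h \<ge> 0\<close>
  there. If \<open>h q > 0\<close> at a point \<open>q\<close> of the sphere, then \<open>f q\<close> lies in the ball, so that it is also the image
  of a point of the ball, which contradicts injectivity.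
\<close>

lemma Moebius_group_form:
  assumes f: "f \<in> \<bbbM>"
  obtains a b c d \<kappa> where
    "f = (\<lambda>q. (a * q + b) * inverse (c * q + d))"
    "\<And>q. q \<in> \<Delta> \<Longrightarrow> c * q + d \<noteq> 0"
    "\<kappa> > 0" "(norm a)\<^sup>2 - (norm c)\<^sup>2 = \<kappa>" "(norm d)\<^sup>2 - (norm b)\<^sup>2 = \<kappa>"
    "qconj c * d = qconj a * b"
proof -
  from f obtain A :: "quat^2^2" where fA: "f = moebius A" and inv: "invertible A"
    and np: "\<And>q. q \<in> \<Delta> \<Longrightarrow> A $ 2 $ 1 * q + A $ 2 $ 2 \<noteq> 0" and im: "moebius A ` \<Delta> = \<Delta>"
    unfolding Moebius_group_def by blast
  define a b c d where "a = A $ 1 $ 1" and "b = A $ 1 $ 2" and "c = A $ 2 $ 1" and "d = A $ 2 $ 2"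
  note abcd = a_def b_def c_def d_def
  have feq: "f = (\<lambda>q. (a * q + b) * inverse (c * q + d))"
    by (simp add: fA moebius_def abcd fun_eq_iff)
  have np': "c * q + d \<noteq> 0" if "q \<in> \<Delta>" for q using np[OF that] by (simp add: abcd)
  obtain B :: "quat^2^2" where B: "B ** A = mat 1" using inv by (auto simp: invertible_def)
  have B': "(B ** A) $ i $ j = (mat 1 :: quat^2^2) $ i $ j" for i j by (simp add: B)
  have B11: "B $ 1 $ 1 * a + B $ 1 $ 2 * c = 1" and B12: "B $ 1 $ 1 * b + B $ 1 $ 2 * d = 0"
    and B21: "B $ 2 $ 1 * a + B $ 2 $ 2 * c = 0" and B22: "B $ 2 $ 1 * b + B $ 2 $ 2 * d = 1"
    using B'[of 1 1] B'[of 1 2] B'[of 2 1] B'[of 2 2]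
    by (simp_all add: matrix_matrix_mult_def mat_def sum_2 abcd)
  \<comment> \<open>the inverse matrix recovers q from f q wherever the denominator is nonzero\<close>
  have recover: "q = (B $ 1 $ 1 * f q + B $ 1 $ 2) * inverse (B $ 2 $ 1 * f q + B $ 2 $ 2)"
    if nz: "c * q + d \<noteq> 0" for q
  proof -
    define m where "m = c * q + d"
    have m: "m * inverse m = 1" using nz by (simp add: m_def)
    have "B $ 1 $ 1 * (a * q + b) + B $ 1 $ 2 * m =
        (B $ 1 $ 1 * a + B $ 1 $ 2 * c) * q + (B $ 1 $ 1 * b + B $ 1 $ 2 * d)"
      by (simp add: m_def algebra_simps)
    then have 1: "B $ 1 $ 1 * (a * q + b) + B $ 1 $ 2 * m = q" by (simp add: B11 B12)
    have "B $ 2 $ 1 * (a * q + b) + B $ 2 $ 2 * m =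
        (B $ 2 $ 1 * a + B $ 2 $ 2 * c) * q + (B $ 2 $ 1 * b + B $ 2 $ 2 * d)"
      by (simp add: m_def algebra_simps)
    then have 2: "B $ 2 $ 1 * (a * q + b) + B $ 2 $ 2 * m = 1" by (simp add: B21 B22)
    have fq: "f q = (a * q + b) * inverse m" by (simp add: feq m_def)
    have "B $ 1 $ 1 * f q + B $ 1 $ 2 = (B $ 1 $ 1 * (a * q + b) + B $ 1 $ 2 * m) * inverse m"
      by (simp add: fq distrib_right mult.assoc m)
    moreover have "B $ 2 $ 1 * f q + B $ 2 $ 2 = (B $ 2 $ 1 * (a * q + b) + B $ 2 $ 2 * m) * inverse m"
      by (simp add: fq distrib_right mult.assoc m)
    moreover have "inverse m \<noteq> 0" using nz by (simp add: m_def)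
    ultimately show ?thesis unfolding 1 2 using nz by (simp add: mult.assoc m_def)
  qed
  define h where "h = (\<lambda>q. (norm (c * q + d))\<^sup>2 - (norm (a * q + b))\<^sup>2)"
  have norm_f: "norm (f q) = norm (a * q + b) / norm (c * q + d)" for q
    by (simp add: feq norm_mult norm_inverse divide_inverse)
  have hpos: "h q > 0" if "q \<in> \<Delta>" for q
  proof -
    have "norm (f q) < 1" using im that fA by auto
    then have "norm (a * q + b) < norm (c * q + d)" using np'[OF that] by (simp add: norm_f)
    then show ?thesis by (simp add: h_def power_strict_mono)
  qed
  have h0: "h q = 0" if q: "norm q = 1" for q
  proof (rule ccontr)
    assume nz: "h q \<noteq> 0"
    have "h q \<ge> 0"
    proof (rule continuous_ge_on_closure[where S = "\<Delta>" and f = h])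
      show "continuous_on (closure \<Delta>) h" unfolding h_def by (intro continuous_intros)
    qed (use q hpos in \<open>auto intro: less_imp_le\<close>)
    with nz have pos: "h q > 0" by simp
    then have "(norm (a * q + b))\<^sup>2 < (norm (c * q + d))\<^sup>2" by (simp add: h_def)
    then have lt: "norm (a * q + b) < norm (c * q + d)" by (rule power_less_imp_less_base) simp
    then have cq: "c * q + d \<noteq> 0" using norm_ge_zero[of "a * q + b"] by auto
    then have "f q \<in> \<Delta>" using lt by (simp add: norm_f)
    then obtain q' where q': "q' \<in> \<Delta>" "f q' = f q" using im fA by (metis imageE)
    then have "q' = q" using recover[OF cq] recover[OF np'[OF q'(1)]] by simp
    then show False using q q'(1) by simp
  qed
  define w where "w = qconj c * d - qconj a * b"
  define p s where "p = (norm c)\<^sup>2 - (norm a)\<^sup>2" and "s = (norm d)\<^sup>2 - (norm b)\<^sup>2"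
  have hexp: "h q = p * (norm q)\<^sup>2 + 2 * inner q w + s" for q
  proof -
    have sq: "(norm (x + y))\<^sup>2 = (norm x)\<^sup>2 + 2 * inner x y + (norm y)\<^sup>2" for x y :: quat
      by (simp add: power2_norm_eq_inner inner_add_left inner_add_right inner_commute)
    show ?thesis
      unfolding h_def sq inner_mult_left_quat p_def s_def w_def
      by (simp add: norm_mult power_mult_distrib inner_diff_right left_diff_distrib)
  qed
  \<comment> \<open>antipodal points of the sphere separate the linear term of h from the even terms\<close>
  have "w = 0"
  proof (rule ccontr)
    assume w: "w \<noteq> 0"
    have "h (sgn w) = 0" "h (- sgn w) = 0" using w by (auto intro!: h0 simp: norm_sgn)
    then have "inner (sgn w) w = 0" by (simp add: hexp)
    then show False using w by (simp add: sgn_div_norm)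
  qed
  then have ps: "p = - s" using h0[of 1] by (simp add: hexp)
  have "s > 0" using hpos[of 0] by (simp add: hexp)
  from feq np' this show thesis
  proof (rule that)
    show "(norm a)\<^sup>2 - (norm c)\<^sup>2 = s" using ps by (simp add: p_def)
    show "(norm d)\<^sup>2 - (norm b)\<^sup>2 = s" by (simp add: s_def)
    show "qconj c * d = qconj a * b" using \<open>w = 0\<close> by (simp add: w_def)
  qed
qed

text \<open>
  Both \<open>|1 - x\<^sup>* y|\<^sup>2\<close> and \<open>(1 - |x|\<^sup>2) (1 - |y|\<^sup>2)\<close> pick up the factor
  \<open>\<kappa>\<^sup>2 / (|c x + d|\<^sup>2 |c y + d|\<^sup>2)\<close>, so their quotient \<open>1 + hyp_ratio x y\<close> does not change.
\<close>

lemma hyp_ratio_Moebius: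
  assumes f: "f \<in> \<bbbM>" and x: "x \<in> \<Delta>" and y: "y \<in> \<Delta>"
  shows "hyp_ratio (f x) (f y) = hyp_ratio x y"
proof -
  obtain a b c d \<kappa> where feq: "f = (\<lambda>q. (a * q + b) * inverse (c * q + d))"
    and np: "\<And>q. q \<in> \<Delta> \<Longrightarrow> c * q + d \<noteq> 0"
    and \<kappa>: "\<kappa> > 0" "(norm a)\<^sup>2 - (norm c)\<^sup>2 = \<kappa>" "(norm d)\<^sup>2 - (norm b)\<^sup>2 = \<kappa>"
    and cd: "qconj c * d = qconj a * b"
    by (rule Moebius_group_form[OF f]) blast
  have dc: "qconj d * c = qconj b * a"
    using arg_cong[OF cd, of qconj] by (simp add: qconj_mult) (simp add: qconj_def)
  define M where "M q = c * q + d" for q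
  define N where "N q = a * q + b" for q
  have fN: "f q = N q * inverse (M q)" for q by (simp add: feq M_def N_def)
  have form: "qconj (M q) * M r - qconj (N q) * N r = of_real \<kappa> * (1 - qconj q * r)" for q r
  proof -
    have exp: "qconj (k * q + l) * (k * r + l) =
      qconj q * (qconj k * k) * r + qconj q * (qconj k * l) + (qconj l * k) * r + qconj l * l" for k l
      by (simp add: qconj_add qconj_mult algebra_simps)
    have "qconj (M q) * M r - qconj (N q) * N r =
       qconj q * (of_real ((norm c)\<^sup>2) - of_real ((norm a)\<^sup>2)) * r +
       (of_real ((norm d)\<^sup>2) - of_real ((norm b)\<^sup>2))"
      unfolding M_def N_def exp cd dc qconj_mult_self by (simp add: algebra_simps)
    also have "of_real ((norm c)\<^sup>2) - of_real ((norm a)\<^sup>2) = - (of_real \<kappa> :: quat)"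
      unfolding \<kappa>(2)[symmetric] by simp
    also have "of_real ((norm d)\<^sup>2) - of_real ((norm b)\<^sup>2) = (of_real \<kappa> :: quat)"
      unfolding \<kappa>(3)[symmetric] by simp
    finally show ?thesis unfolding of_real_def by (simp add: scaleR_diff_right)
  qed
  have cross: "norm (1 - qconj (f q) * f r) = \<kappa> * norm (1 - qconj q * r) / (norm (M q) * norm (M r))"
    if q: "q \<in> \<Delta>" and r: "r \<in> \<Delta>" for q r
  proof -
    have nz: "M q \<noteq> 0" "M r \<noteq> 0" using np q r by (auto simp: M_def)
    have "qconj (M q) * (1 - qconj (f q) * f r) * M r
        = qconj (M q) * M r - qconj (f q * M q) * (f r * M r)"
      by (simp add: qconj_mult algebra_simps)
    moreover have "f q * M q = N q" "f r * M r = N r" using nz by (simp_all add: fN mult.assoc)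
    ultimately have "norm (qconj (M q) * (1 - qconj (f q) * f r) * M r) = norm (of_real \<kappa> * (1 - qconj q * r))"
      by (simp add: form)
    then have "norm (M q) * norm (1 - qconj (f q) * f r) * norm (M r) = \<kappa> * norm (1 - qconj q * r)"
      using \<kappa>(1) by (simp only: norm_mult norm_qconj norm_of_real abs_of_pos)
    then show ?thesis using nz by (simp add: nonzero_eq_divide_eq mult_ac)
  qed
  have self: "1 - (norm (f q))\<^sup>2 = \<kappa> * (1 - (norm q)\<^sup>2) / (norm (M q))\<^sup>2" if q: "q \<in> \<Delta>" for q
  proof -
    have nz: "M q \<noteq> 0" using np q by (auto simp: M_def)
    have "of_real ((norm (M q))\<^sup>2 - (norm (N q))\<^sup>2) = (of_real (\<kappa> * (1 - (norm q)\<^sup>2)) :: quat)"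
      using form[of q q] by (simp add: qconj_mult_self)
    then have "(norm (M q))\<^sup>2 - (norm (N q))\<^sup>2 = \<kappa> * (1 - (norm q)\<^sup>2)" by (simp only: of_real_eq_iff)
    moreover have nf: "norm (f q) = norm (N q) / norm (M q)"
      by (simp add: fN norm_mult norm_inverse divide_inverse)
    ultimately show ?thesis unfolding nf power_divide using nz by (simp add: field_simps)
  qed
  have nz: "M x \<noteq> 0" "M y \<noteq> 0" using np x y by (auto simp: M_def)
  have pos: "1 - (norm x)\<^sup>2 > 0" "1 - (norm y)\<^sup>2 > 0" using x y by (auto simp: power_less_one_iff)
  have one: "1 + hyp_ratio u v = (norm (1 - qconj u * v))\<^sup>2 / ((1 - (norm u)\<^sup>2) * (1 - (norm v)\<^sup>2))"
    if "1 - (norm u)\<^sup>2 > 0" "1 - (norm v)\<^sup>2 > 0" for u v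
    using that by (simp add: hyp_ratio_def norm_one_minus_qconj_mult add_divide_distrib)
  have posf: "1 - (norm (f x))\<^sup>2 > 0" "1 - (norm (f y))\<^sup>2 > 0"
    unfolding self[OF x] self[OF y] using nz pos \<kappa>(1) by simp_all
  have "1 + hyp_ratio (f x) (f y) = 1 + hyp_ratio x y"
    unfolding one[OF posf] one[OF pos] cross[OF x y] self[OF x] self[OF y]
    using nz \<kappa>(1) by (simp add: power_mult_distrib power_divide power2_eq_square)
  then show ?thesis by simp
qed

lemma hyp_ratio_qconj: "hyp_ratio (qconj a) (qconj b) = hyp_ratio a b"
  by (simp add: hyp_ratio_def flip: qconj_diff)

section \<open>The cross-ratio of four points in cyclic order\<close>

text \<open>
  The metric content of cyclic order: the first two conditions make the logarithm of the cross-ratio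
  positive, and the two equations with chord lengths express \<open>r\<close> and \<open>r - 1\<close> symmetrically
  enough to eliminate the ends of the line later.
\<close>

definition separated_cross_ratio :: "quat \<Rightarrow> quat \<Rightarrow> quat \<Rightarrow> quat \<Rightarrow> bool" where
  "separated_cross_ratio x1 x2 x3 x4 \<longleftrightarrow>
     (\<exists>r. r > 1 \<and> cross_ratio x1 x2 x3 x4 = of_real r \<and> norm (x1 - x4) * norm (x2 - x3) > 0 \<and>
          r * (norm (x1 - x4) * norm (x2 - x3)) = norm (x1 - x3) * norm (x2 - x4) \<and>
          (r - 1) * (norm (x1 - x4) * norm (x2 - x3)) = norm (x1 - x2) * norm (x3 - x4))"

lemma cross_ratio_pull_of_real:
  fixes x y z w :: quat
  shows "(of_real p * x) * inverse (of_real q * y) * (of_real p' * z) * inverse (of_real q' * w) =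
      of_real (p * p' / (q * q')) * (x * inverse y * z * inverse w)"
  unfolding scaleR_conv_of_real [symmetric] inverse_scaleR_distrib
  by (simp add: divide_inverse mult_ac)

lemma circle_point_diff:
  "circle_point c r u v s - circle_point c r u v t =
     (2 * r * sin ((s - t) / 2)) *\<^sub>R (- sin ((s + t) / 2) *\<^sub>R u + cos ((s + t) / 2) *\<^sub>R v)"
proof -
  have cosd: "cos s - cos t = - 2 * sin ((s - t) / 2) * sin ((s + t) / 2)"
  proof -
    have "(t - s) / 2 = - ((s - t) / 2)" by (simp add: field_simps)
    then show ?thesis by (simp only: cos_diff_cos sin_minus) simp
  qed
  have sind: "sin s - sin t = 2 * sin ((s - t) / 2) * cos ((s + t) / 2)"
    by (simp add: sin_diff_sin)
  have "circle_point c r u v s - circle_point c r u v t =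
      (r * (cos s - cos t)) *\<^sub>R u + (r * (sin s - sin t)) *\<^sub>R v"
    by (simp add: circle_point_def algebra_simps)
  then show ?thesis unfolding cosd sind by (simp add: algebra_simps)
qed

lemma norm_sin_cos_combination:
  fixes u v :: quat
  assumes "norm u = 1" "norm v = 1" "orthogonal u v"
  shows "(norm (x *\<^sub>R u + y *\<^sub>R v))\<^sup>2 = x\<^sup>2 + y\<^sup>2"
proof -
  have "inner u u = 1" "inner v v = 1" "inner u v = 0" "inner v u = 0"
    using assms by (auto simp: norm_eq_1 orthogonal_def inner_commute)
  then show ?thesis
    unfolding power2_norm_eq_inner by (simp add: inner_add_left inner_add_right power2_eq_square)
qed

lemma norm_circle_point_diff:
  assumes "norm u = 1" "norm v = 1" "orthogonal u v" "r > 0"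
  shows "norm (circle_point c r u v s - circle_point c r u v t) = 2 * r * \<bar>sin ((s - t) / 2)\<bar>"
proof -
  have "(norm (- sin ((s + t) / 2) *\<^sub>R u + cos ((s + t) / 2) *\<^sub>R v))\<^sup>2 = 1"
    unfolding norm_sin_cos_combination[OF assms(1-3)] by simp
  then have "norm (- sin ((s + t) / 2) *\<^sub>R u + cos ((s + t) / 2) *\<^sub>R v) = 1"
    by (simp add: power2_eq_1_iff) (smt (verit) norm_ge_zero)
  then show ?thesis using assms(4) by (simp add: circle_point_diff abs_mult)
qed

text \<open>
  With \<open>n = - v\<^sup>* u\<close>, a purely imaginary unit, every chord is a real multiple of \<open>v E \<phi>\<close> for a point
  \<open>E \<phi> = cos \<phi> + n sin \<phi>\<close> of the commutative one-parameter group generated by \<open>n\<close>. In the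
  cross-ratio the four angles cancel and only the real factors are left.
\<close>

lemma cross_ratio_circle_point:
  assumes uv: "norm u = 1" "norm v = 1" "orthogonal u v" "r > 0"
  shows "cross_ratio (circle_point c r u v t1) (circle_point c r u v t2)
           (circle_point c r u v t3) (circle_point c r u v t4) =
         of_real (sin ((t1 - t3) / 2) * sin ((t2 - t4) / 2) / (sin ((t1 - t4) / 2) * sin ((t2 - t3) / 2)))"
proof -
  define n where "n = - qconj v * u"
  have "Qre n = 0" using uv(3) unfolding orthogonal_def inner_quat_def
    by (simp add: n_def mult.commute)
  moreover have "norm n = 1" using uv by (simp add: n_def norm_mult)
  ultimately have "n * n = - 1"
    unfolding quat_eq_iff norm_quat_def real_sqrt_eq_1_iff by (simp add: power2_eq_square)
  define E where "E \<phi> = of_real (cos \<phi>) + of_real (sin \<phi>) * n" for \<phi>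
  have E_add: "E \<phi> * E \<psi> = E (\<phi> + \<psi>)" for \<phi> \<psi>
  proof -
    have "E \<phi> * E \<psi> = of_real (cos \<phi> * cos \<psi>) + of_real (sin \<phi> * cos \<psi> + cos \<phi> * sin \<psi>) * n
      + of_real (sin \<phi> * sin \<psi>) * (n * n)"
      unfolding E_def by (simp add: quat_eq_iff algebra_simps)
    then show ?thesis unfolding \<open>n * n = - 1\<close>
      by (simp add: E_def cos_add sin_add algebra_simps)
  qed
  have E_0: "E 0 = 1" by (simp add: E_def)
  have E_inv: "inverse (E \<phi>) = E (- \<phi>)" for \<phi>
    by (rule inverse_unique) (simp add: E_add E_0)
  have vv: "v * qconj v = 1"
    using uv(2) by (simp add: quat_eq_iff norm_quat_def power2_eq_square)
  have v0: "v \<noteq> 0" using uv(2) by auto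
  have chord: "circle_point c r u v s - circle_point c r u v t =
      of_real (2 * r * sin ((s - t) / 2)) * (v * E ((s + t) / 2))" for s t
  proof -
    have "v * n = - u" by (simp add: n_def vv flip: mult.assoc)
    then have "v * E \<phi> = - sin \<phi> *\<^sub>R u + cos \<phi> *\<^sub>R v" for \<phi>
      by (simp add: E_def distrib_left scaleR_conv_of_real [symmetric] mult.assoc [symmetric])
         (simp add: of_real_def)
    then show ?thesis by (simp add: circle_point_diff scaleR_conv_of_real)
  qed
  define k where "k s t = 2 * r * sin ((s - t) / 2)" for s t
  have "v * E ((t1 + t3) / 2) * inverse (v * E ((t1 + t4) / 2)) * (v * E ((t2 + t4) / 2)) *
        inverse (v * E ((t2 + t3) / 2)) = v * (E ((t1 + t3) / 2) * (inverse (E ((t1 + t4) / 2)) *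
        (E ((t2 + t4) / 2) * inverse (E ((t2 + t3) / 2))))) * inverse v"
  proof -
    have nz: "E \<phi> \<noteq> 0" for \<phi> using E_add[of \<phi> "- \<phi>"] E_0 by auto
    have "inverse (v * E \<phi>) = inverse (E \<phi>) * inverse v" for \<phi>
      using v0 nz by (simp add: nonzero_inverse_mult_distrib)
    moreover have "inverse v * (v * x) = x" for x using v0 by (simp flip: mult.assoc)
    ultimately show ?thesis by (simp add: mult.assoc)
  qed
  also have "\<dots> = v * E 0 * inverse v"
    by (simp add: E_inv E_add) (simp add: field_simps)
  also have "\<dots> = 1" using v0 by (simp add: E_0)
  finally have one: "v * E ((t1 + t3) / 2) * inverse (v * E ((t1 + t4) / 2)) * (v * E ((t2 + t4) / 2)) *
        inverse (v * E ((t2 + t3) / 2)) = 1" .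
  have "cross_ratio (circle_point c r u v t1) (circle_point c r u v t2)
           (circle_point c r u v t3) (circle_point c r u v t4) =
        of_real (k t1 t3 * k t2 t4 / (k t1 t4 * k t2 t3))"
    unfolding cross_ratio_def chord cross_ratio_pull_of_real one by (simp add: k_def)
  also have "k t1 t3 * k t2 t4 / (k t1 t4 * k t2 t3) =
     sin ((t1 - t3) / 2) * sin ((t2 - t4) / 2) / (sin ((t1 - t4) / 2) * sin ((t2 - t3) / 2))"
    using uv(4) by (simp add: k_def)
  finally show ?thesis .
qed

text \<open>
  Ptolemy's theorem for a quadrilateral inscribed in a circle, with the chords written as sines.
\<close>

lemma Ptolemy_sin:
  fixes x y z :: real
  shows "sin (x + y) * sin (y + z) = sin x * sin z + sin y * sin (x + y + z)"
proof -
  have "sin (x + y) * sin (y + z) - sin y * sin (x + y + z) = sin x * sin z * ((sin y)\<^sup>2 + (cos y)\<^sup>2)"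
    by (simp only: sin_add cos_add) algebra
  then show ?thesis by simp
qed

text \<open>
  Circles and lines are treated alike: \<open>f\<close> is the signed chord length, a sine for a circle and the
  identity for a line. In each of the four cases of the cyclic order the two products \<open>A\<close> and \<open>B\<close> on the
  right of Ptolemy's identity have the same sign, hence the cross-ratio \<open>(A + B) / B\<close> exceeds 1.
\<close>

lemma cross_ratio_chords:
  assumes cyc: "cyclic_order t1 t2 t3 t4"
    and pos: "\<And>s t. s \<in> {t1, t2, t3, t4} \<Longrightarrow> t \<in> {t1, t2, t3, t4} \<Longrightarrow> s < t \<Longrightarrow> f (t - s) > 0"
    and odd: "\<And>t. f (- t) = - f t"
    and ptolemy: "f (t3 - t1) * f (t4 - t2) = f (t2 - t1) * f (t4 - t3) + f (t3 - t2) * f (t4 - t1)"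
    and k: "k > (0 :: real)"
    and dist: "\<And>s t. norm (\<gamma> s - \<gamma> t) = k * \<bar>f (s - t)\<bar>"
    and cr: "cross_ratio (\<gamma> t1) (\<gamma> t2) (\<gamma> t3) (\<gamma> t4) =
        of_real (f (t1 - t3) * f (t2 - t4) / (f (t1 - t4) * f (t2 - t3)))"
  shows "separated_cross_ratio (\<gamma> t1) (\<gamma> t2) (\<gamma> t3) (\<gamma> t4)"
proof -
  define A where "A = f (t2 - t1) * f (t4 - t3)"
  define B where "B = f (t3 - t2) * f (t4 - t1)"
  have odd': "f (s - t) = - f (t - s)" for s t using odd[of "t - s"] by simp
  have lt: "f (t - s) > 0 \<and> f (s - t) < 0"
    if "s \<in> {t1, t2, t3, t4}" "t \<in> {t1, t2, t3, t4}" "s < t" for s t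
    using pos[OF that] odd'[of s t] by simp
  have "0 < A \<and> 0 < B \<or> A < 0 \<and> B < 0"
    using cyc unfolding cyclic_order_def
    by (elim disjE conjE)
       (insert lt, auto simp: A_def B_def zero_less_mult_iff mult_less_0_iff)
  then have AB: "A / B > 0" "B \<noteq> 0" by (auto simp: zero_less_divide_iff)
  have AB': "f (t1 - t3) * f (t2 - t4) = A + B" "f (t1 - t4) * f (t2 - t3) = B"
    using ptolemy odd'[of t1 t3] odd'[of t2 t4] odd'[of t1 t4] odd'[of t2 t3]
    by (simp_all add: A_def B_def mult.commute)
  have A': "\<bar>f (t1 - t2)\<bar> * \<bar>f (t3 - t4)\<bar> = \<bar>A\<bar>"
    using odd'[of t1 t2] odd'[of t3 t4] by (simp add: A_def abs_mult)
  have prod: "norm (\<gamma> s - \<gamma> t) * norm (\<gamma> s' - \<gamma> t') = k\<^sup>2 * \<bar>f (s - t) * f (s' - t')\<bar>" for s t s' t'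
    by (simp add: dist abs_mult power2_eq_square)
  have prods: "norm (\<gamma> t1 - \<gamma> t4) * norm (\<gamma> t2 - \<gamma> t3) = k\<^sup>2 * \<bar>B\<bar>"
     "norm (\<gamma> t1 - \<gamma> t3) * norm (\<gamma> t2 - \<gamma> t4) = k\<^sup>2 * \<bar>A + B\<bar>"
     "norm (\<gamma> t1 - \<gamma> t2) * norm (\<gamma> t3 - \<gamma> t4) = k\<^sup>2 * \<bar>A\<bar>"
    unfolding prod AB' by (simp_all add: abs_mult A')
  have r: "(A + B) / B = 1 + A / B" using AB by (simp add: field_simps)
  show ?thesis
    unfolding separated_cross_ratio_def prods
  proof (intro exI[of _ "1 + A / B"] conjI)
    show "cross_ratio (\<gamma> t1) (\<gamma> t2) (\<gamma> t3) (\<gamma> t4) = of_real (1 + A / B)"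
      unfolding cr AB' r ..
    have "A + B = (1 + A / B) * B" using AB by (simp add: field_simps)
    moreover have "\<bar>1 + A / B\<bar> = 1 + A / B" using AB by simp
    ultimately have "\<bar>A + B\<bar> = (1 + A / B) * \<bar>B\<bar>" by (metis abs_mult)
    then show "(1 + A / B) * (k\<^sup>2 * \<bar>B\<bar>) = k\<^sup>2 * \<bar>A + B\<bar>" by simp
    have "\<bar>A\<bar> = \<bar>A / B * B\<bar>" using AB by simp
    also have "\<dots> = A / B * \<bar>B\<bar>" using AB by (simp only: abs_mult abs_of_pos)
    finally show "(1 + A / B - 1) * (k\<^sup>2 * \<bar>B\<bar>) = k\<^sup>2 * \<bar>A\<bar>" by simp
  qed (use AB k in auto)
qed

lemma cyclically_arranged_imp_separated:
  assumes "cyclically_arranged L x1 x2 x3 x4"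
  shows "separated_cross_ratio x1 x2 x3 x4"
proof -
  from assms obtain \<gamma> T t1 t2 t3 t4 where
    \<gamma>T: "circle_param L \<gamma> \<and> T = {0..<2 * pi} \<or> (\<exists>a u. u \<noteq> 0 \<and> \<gamma> = (\<lambda>t. a + t *\<^sub>R u) \<and> L \<subseteq> range \<gamma> \<and> T = UNIV)"
    and T: "t1 \<in> T" "t2 \<in> T" "t3 \<in> T" "t4 \<in> T" and cyc: "cyclic_order t1 t2 t3 t4"
    and x: "x1 = \<gamma> t1" "x2 = \<gamma> t2" "x3 = \<gamma> t3" "x4 = \<gamma> t4"
    unfolding cyclically_arranged_def by (elim conjE exE bexE) (rule that; assumption)
  from \<gamma>T show ?thesis
  proof (elim disjE exE conjE)
    assume "circle_param L \<gamma>" and Teq: "T = {0..<2 * pi}"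
    then obtain c r u v where r: "r > 0" and uv: "norm u = 1" "norm v = 1" "orthogonal u v"
      and \<gamma>: "\<gamma> = circle_point c r u v"
      unfolding circle_param_def by blast
    show ?thesis unfolding x
    proof (rule cross_ratio_chords[where f = "\<lambda>t. sin (t / 2)" and k = "2 * r"])
      show "sin ((t - s) / 2) > 0" if "s \<in> {t1, t2, t3, t4}" "t \<in> {t1, t2, t3, t4}" "s < t" for s t
      proof (rule sin_gt_zero)
        have "s \<in> T" "t \<in> T" using that T by auto
        then show "0 < (t - s) / 2" "(t - s) / 2 < pi" using \<open>s < t\<close> by (auto simp: Teq)
      qed
      show "sin ((t3 - t1) / 2) * sin ((t4 - t2) / 2) =
          sin ((t2 - t1) / 2) * sin ((t4 - t3) / 2) + sin ((t3 - t2) / 2) * sin ((t4 - t1) / 2)"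
        using Ptolemy_sin[of "(t2 - t1) / 2" "(t3 - t2) / 2" "(t4 - t3) / 2"]
        by (simp flip: add_divide_distrib)
    qed (use cyc r in \<open>simp_all add: \<gamma> norm_circle_point_diff[OF uv r] cross_ratio_circle_point[OF uv r]\<close>)
  next
    fix a u :: quat
    assume u: "u \<noteq> 0" and \<gamma>: "\<gamma> = (\<lambda>t. a + t *\<^sub>R u)"
    have diff: "\<gamma> s - \<gamma> t = of_real (s - t) * u" for s t
      by (simp add: \<gamma> scaleR_conv_of_real algebra_simps)
    have "cross_ratio (\<gamma> t1) (\<gamma> t2) (\<gamma> t3) (\<gamma> t4) =
       of_real ((t1 - t3) * (t2 - t4) / ((t1 - t4) * (t2 - t3)))"
      unfolding cross_ratio_def diff cross_ratio_pull_of_real using u by (simp add: mult.assoc)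
    then show ?thesis unfolding x using u
      by (intro cross_ratio_chords[where f = "\<lambda>t. t" and k = "norm u"])
         (use cyc in \<open>auto simp: diff norm_mult algebra_simps simp flip: of_real_diff\<close>)
  qed
qed

section \<open>From the ends of the line to the distance\<close>

lemma ln_eq_arcosh:
  fixes r :: real
  assumes "r > 1" "(r - 1)\<^sup>2 = 4 * K * r"
  shows "ln r = arcosh (1 + 2 * K)"
proof -
  have "cosh (ln r) = (r + inverse r) / 2" using assms by (simp add: cosh_ln_real)
  also have "\<dots> = 1 + 2 * K" using assms by (simp add: field_simps power2_eq_square)
  finally show ?thesis using arcosh_cosh_real[of "ln r"] assms by simp
qed

text \<open>
  Multiplying the chord identities eliminates the ends: the chords from \<open>a\<close> and \<open>b\<close> to the ends enter
  \<open>(r - 1)\<^sup>2 / r\<close> only through the two products given by the last hypotheses. Since \<open>r > 1\<close>,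
  this value determines \<open>r\<close>, so every numbering of the ends that respects the cyclic order gives the
  same logarithm.
\<close>

lemma poincare_dist_eqI:
  assumes ab: "a \<noteq> b" "norm a < 1" "norm b < 1"
    and ends: "noneuclidean_line a b \<inter> sphere 0 1 = {e1, e2}"
    and cyc: "cyclically_arranged (noneuclidean_line a b) a b e1 e2"
    and pa: "norm (a - e1) * norm (a - e2) = (1 - (norm a)\<^sup>2) * norm (e1 - e2) / 2"
    and pb: "norm (b - e1) * norm (b - e2) = (1 - (norm b)\<^sup>2) * norm (e1 - e2) / 2"
  shows "poincare_dist a b = 1 / 2 * arcosh (1 + 2 * hyp_ratio a b)"
proof -
  have pos: "1 - (norm a)\<^sup>2 > 0" "1 - (norm b)\<^sup>2 > 0" using ab by (auto simp: power_less_one_iff)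
  have key: "ln r = arcosh (1 + 2 * hyp_ratio a b) \<and> r > 1"
    if f: "noneuclidean_line a b \<inter> sphere 0 1 = {f1, f2}"
      and fc: "cyclically_arranged (noneuclidean_line a b) a b f1 f2"
      and cr: "cross_ratio a b f1 f2 = of_real r" for f1 f2 r
  proof -
    obtain r' where r': "r' > 1" "cross_ratio a b f1 f2 = of_real r'"
        "norm (a - f2) * norm (b - f1) > 0"
        "r' * (norm (a - f2) * norm (b - f1)) = norm (a - f1) * norm (b - f2)"
        "(r' - 1) * (norm (a - f2) * norm (b - f1)) = norm (a - b) * norm (f1 - f2)"
      using cyclically_arranged_imp_separated[OF fc] unfolding separated_cross_ratio_def by blast
    have "r' = r" using r'(2) cr by simp
    define m where "m = norm (a - f2) * norm (b - f1)"
    note r = r'[unfolded \<open>r' = r\<close>, folded m_def]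
    \<comment> \<open>the identities for the ends hold for either numbering\<close>
    have "f1 = e1 \<and> f2 = e2 \<or> f1 = e2 \<and> f2 = e1"
      using f ends by (metis doubleton_eq_iff)
    then have prods: "norm (a - f1) * norm (a - f2) = (1 - (norm a)\<^sup>2) * norm (f1 - f2) / 2"
        "norm (b - f1) * norm (b - f2) = (1 - (norm b)\<^sup>2) * norm (f1 - f2) / 2"
      using pa pb by (auto simp: mult.commute norm_minus_commute)
    have "m * (r * m) = (norm (a - f1) * norm (a - f2)) * (norm (b - f1) * norm (b - f2))"
      unfolding r(4) by (simp add: m_def mult_ac)
    also have "\<dots> = (1 - (norm a)\<^sup>2) * (1 - (norm b)\<^sup>2) * (norm (f1 - f2))\<^sup>2 / 4"
      unfolding prods by (simp add: power2_eq_square)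
    finally have 1: "4 * m\<^sup>2 * r = (1 - (norm a)\<^sup>2) * (1 - (norm b)\<^sup>2) * (norm (f1 - f2))\<^sup>2"
      by (simp add: power2_eq_square mult_ac)
    have "((r - 1) * m)\<^sup>2 = (norm (a - b))\<^sup>2 * (norm (f1 - f2))\<^sup>2"
      unfolding r(5) by (simp add: power_mult_distrib)
    also have "\<dots> = hyp_ratio a b * ((1 - (norm a)\<^sup>2) * (1 - (norm b)\<^sup>2) * (norm (f1 - f2))\<^sup>2)"
      using pos by (simp add: hyp_ratio_def)
    also have "\<dots> = hyp_ratio a b * (4 * m\<^sup>2 * r)" unfolding 1 ..
    finally have "m\<^sup>2 * (r - 1)\<^sup>2 = m\<^sup>2 * (4 * hyp_ratio a b * r)" by (simp add: power_mult_distrib mult_ac)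
    then have "(r - 1)\<^sup>2 = 4 * hyp_ratio a b * r" using r(3) by simp
    with r(1) show ?thesis by (auto intro: ln_eq_arcosh)
  qed
  obtain r where "cross_ratio a b e1 e2 = of_real r"
    using cyclically_arranged_imp_separated[OF cyc] unfolding separated_cross_ratio_def by blast
  with key[OF ends cyc] have ex: "cross_ratio a b e1 e2 = of_real r" "r > 0"
    "ln r = arcosh (1 + 2 * hyp_ratio a b)" by auto
  show ?thesis
    unfolding poincare_dist_def if_not_P[OF ab(1)]
  proof (rule the_equality)
    show "\<exists>f1 f2 r. noneuclidean_line a b \<inter> sphere 0 1 = {f1, f2} \<and>
        cyclically_arranged (noneuclidean_line a b) a b f1 f2 \<and> cross_ratio a b f1 f2 = of_real r \<and>
        r > 0 \<and> 1 / 2 * arcosh (1 + 2 * hyp_ratio a b) = 1 / 2 * ln r"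
      using ends cyc ex by metis
  next
    fix d
    assume "\<exists>f1 f2 r. noneuclidean_line a b \<inter> sphere 0 1 = {f1, f2} \<and>
        cyclically_arranged (noneuclidean_line a b) a b f1 f2 \<and> cross_ratio a b f1 f2 = of_real r \<and>
        r > 0 \<and> d = 1 / 2 * ln r"
    then show "d = 1 / 2 * arcosh (1 + 2 * hyp_ratio a b)" using key by auto
  qed
qed

section \<open>Circles orthogonal to the unit sphere\<close>

lemma mem_span_pair: "x \<in> span {u, v} \<longleftrightarrow> (\<exists>s t. x = s *\<^sub>R u + t *\<^sub>R v)"
  for x u v :: "'a :: real_vector"
proof -
  have "x \<in> span {u, v} \<longleftrightarrow> (\<exists>s t. x - s *\<^sub>R u = t *\<^sub>R v)"
    by (auto simp: span_breakdown_eq[of x u] span_singleton)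
  then show ?thesis by (simp add: diff_eq_eq add.commute)
qed

lemma span_pair_eq:
  fixes a b u v :: "'a :: euclidean_space"
  assumes "independent {a, b}" "a \<noteq> b" "a \<in> span {u, v}" "b \<in> span {u, v}"
  shows "span {u, v} = span {a, b}"
proof (rule subset_antisym)
  have "dim (span {u, v}) \<le> card {u, v}" by (simp add: dim_le_card')
  also have "\<dots> \<le> card {a, b}" using assms(2) by (simp add: card_insert_if)
  finally have d: "dim (span {u, v}) \<le> card {a, b}" .
  show "span {u, v} \<subseteq> span {a, b}"
    by (rule card_ge_dim_independent[OF _ assms(1) d]) (use assms in blast)
  show "span {a, b} \<subseteq> span {u, v}" using assms by (intro span_minimal) auto
qed

lemma polar_coordinates:
  fixes x y r :: real
  assumes "x\<^sup>2 + y\<^sup>2 = r\<^sup>2" "r > 0"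
  obtains t where "- pi \<le> t" "t \<le> pi" "x = r * cos t" "y = r * sin t"
proof -
  have "(x / r)\<^sup>2 + (y / r)\<^sup>2 = 1" using assms by (simp add: power_divide flip: add_divide_distrib)
  then obtain t where t: "0 \<le> t" "t < 2 * pi" "x / r = cos t" "y / r = sin t"
    by (rule sincos_total_2pi)
  then have xy: "x = r * cos t" "y = r * sin t" using assms(2) by (simp_all add: field_simps)
  show thesis
  proof (cases "t \<le> pi")
    case True then show ?thesis using that[of t] t xy by simp
  next
    case False
    have "cos (t - 2 * pi) = cos t" "sin (t - 2 * pi) = sin t" by (simp_all add: cos_diff sin_diff)
    with False show ?thesis using that[of "t - 2 * pi"] t xy by simp
  qed
qed

lemma circle_point_on_circle:
  assumes uv: "norm u = 1" "norm v = 1" "orthogonal u v" and r: "r > 0"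
  shows "x \<in> range (circle_point c r u v) \<longleftrightarrow> x - c \<in> span {u, v} \<and> norm (x - c) = r"
proof
  assume "x \<in> range (circle_point c r u v)"
  then obtain t where "x = circle_point c r u v t" by blast
  then have xc: "x - c = (r * cos t) *\<^sub>R u + (r * sin t) *\<^sub>R v" by (simp add: circle_point_def)
  have "(norm (x - c))\<^sup>2 = r\<^sup>2"
    unfolding xc norm_sin_cos_combination[OF uv] by (simp add: power_mult_distrib flip: distrib_left)
  then show "x - c \<in> span {u, v} \<and> norm (x - c) = r"
    using r xc by (auto simp: mem_span_pair power2_eq_iff_nonneg)
next
  assume x: "x - c \<in> span {u, v} \<and> norm (x - c) = r"
  then obtain s t where st: "x - c = s *\<^sub>R u + t *\<^sub>R v" by (auto simp: mem_span_pair)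
  have "s\<^sup>2 + t\<^sup>2 = r\<^sup>2" using x norm_sin_cos_combination[OF uv, of s t] by (simp add: st)
  then obtain \<phi> where "s = r * cos \<phi>" "t = r * sin \<phi>" using r polar_coordinates by metis
  then have "x = circle_point c r u v \<phi>" using st by (simp add: circle_point_def algebra_simps)
  then show "x \<in> range (circle_point c r u v)" by blast
qed

lemma vector_derivative_circle_point:
  "vector_derivative (circle_point c r u v) (at t) = (r * - sin t) *\<^sub>R u + (r * cos t) *\<^sub>R v"
proof (rule vector_derivative_at)
  show "(circle_point c r u v has_vector_derivative (r * - sin t) *\<^sub>R u + (r * cos t) *\<^sub>R v) (at t)"
    unfolding circle_point_def [abs_def] has_vector_derivative_def
    by (auto intro!: derivative_eq_intros simp: algebra_simps fun_eq_iff)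
qed

text \<open>
  Let \<open>\<nu>\<close> and \<open>\<tau>\<close> be the unit radius and tangent directions at a common point \<open>p\<close> of circle and sphere.
  Orthogonality makes \<open>\<tau>\<close> parallel to \<open>p\<close>. So \<open>p\<close>, and with it the centre \<open>c = p - r \<nu>\<close>, lies in the
  linear span of the directions of the circle, and \<open>|c|\<^sup>2 = 1 + r\<^sup>2\<close>, which turns the equation of the
  circle into \<open>|x|\<^sup>2 + 1 = 2 \<langle>x, c\<rangle>\<close>.
\<close>

lemma circle_orthogonal_to_sphereE:
  assumes "circle_orthogonal_to_sphere C"
  obtains c u v where "c \<in> span {u, v}"
    "C = {x \<in> span {u, v}. (norm x)\<^sup>2 + 1 = 2 * inner x c}"
proof -
  obtain \<gamma> where \<gamma>: "circle_param C \<gamma>" and ne: "C \<inter> sphere 0 1 \<noteq> {}"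
    and orth_\<gamma>: "\<And>t w. \<gamma> t \<in> sphere 0 1 \<Longrightarrow> orthogonal (\<gamma> t) w \<Longrightarrow> orthogonal (vector_derivative \<gamma> (at t)) w"
    using assms unfolding circle_orthogonal_to_sphere_def by blast
  obtain c r u v where r: "r > 0" and uv: "norm u = 1" "norm v = 1" "orthogonal u v"
    and \<gamma>': "\<gamma> = circle_point c r u v" and C: "C = range (circle_point c r u v)"
    using \<gamma> unfolding circle_param_def by blast
  note orth = orth_\<gamma>[unfolded \<gamma>']
  obtain t where t: "circle_point c r u v t \<in> sphere 0 1" using ne C by auto
  define p where "p = circle_point c r u v t"
  define \<nu> where "\<nu> = cos t *\<^sub>R u + sin t *\<^sub>R v"
  define \<tau> where "\<tau> = - sin t *\<^sub>R u + cos t *\<^sub>R v"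
  have np: "norm p = 1" using t by (simp add: p_def)
  have pc: "p = c + r *\<^sub>R \<nu>" by (simp add: p_def \<nu>_def circle_point_def algebra_simps)
  have i: "inner u u = 1" "inner v v = 1" "inner u v = 0" "inner v u = 0"
    using uv by (auto simp: norm_eq_1 orthogonal_def inner_commute)
  have n\<nu>: "inner \<nu> \<nu> = 1"
    using norm_sin_cos_combination[OF uv, of "cos t" "sin t"] by (simp add: \<nu>_def flip: power2_norm_eq_inner)
  have n\<tau>: "inner \<tau> \<tau> = 1"
    using norm_sin_cos_combination[OF uv, of "- sin t" "cos t"] by (simp add: \<tau>_def flip: power2_norm_eq_inner)
  have \<nu>\<tau>: "inner \<nu> \<tau> = 0"
    unfolding \<nu>_def \<tau>_def by (simp add: inner_add_left inner_add_right inner_diff_left inner_diff_right i)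
  \<comment> \<open>the part of the tangent that is tangential to the sphere; it is orthogonal to itself\<close>
  define w where "w = \<tau> - inner \<tau> p *\<^sub>R p"
  have pp: "inner p p = 1" using np by (simp add: norm_eq_1)
  have "orthogonal p w" by (simp add: w_def orthogonal_def inner_diff_right pp inner_commute)
  then have "orthogonal (r *\<^sub>R \<tau>) w"
    using orth[OF t, of w] by (simp add: p_def vector_derivative_circle_point \<tau>_def scaleR_right_distrib scaleR_right_diff_distrib)
  then have "inner \<tau> w = 0" using r by (simp add: orthogonal_def)
  moreover have "inner p w = 0" using \<open>orthogonal p w\<close> by (simp add: orthogonal_def)
  ultimately have "inner w w = 0" by (simp add: w_def inner_diff_left)
  then have \<tau>p: "\<tau> = inner \<tau> p *\<^sub>R p" by (simp add: w_def)
  then have "inner \<tau> p \<noteq> 0" using n\<tau> by auto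
  moreover have "inner \<nu> p * inner \<tau> p = 0" using \<nu>\<tau> \<tau>p by (metis inner_scaleR_right mult.commute)
  ultimately have \<nu>p: "inner \<nu> p = 0" by simp
  have "p \<in> span {u, v}"
  proof -
    have "p = (1 / inner \<tau> p) *\<^sub>R \<tau>" using \<tau>p \<open>inner \<tau> p \<noteq> 0\<close>
      by (metis divide_inverse mult_1 real_vector.scale_left_imp_eq scaleR_scaleR scaleR_one right_inverse mult.commute)
    moreover have "\<tau> \<in> span {u, v}" unfolding \<tau>_def mem_span_pair by blast
    ultimately show ?thesis by (metis span_scale)
  qed
  moreover have \<nu>s: "\<nu> \<in> span {u, v}" unfolding \<nu>_def mem_span_pair by blast
  moreover have c: "c = p - r *\<^sub>R \<nu>" by (simp add: pc)
  ultimately have cs: "c \<in> span {u, v}" by (simp add: span_diff span_scale)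
  have cc: "inner c c = 1 + r\<^sup>2"
    using \<nu>p by (simp add: c inner_diff_left inner_diff_right pp n\<nu> inner_commute power2_eq_square)
  have "x \<in> C \<longleftrightarrow> x \<in> span {u, v} \<and> (norm x)\<^sup>2 + 1 = 2 * inner x c" for x
  proof -
    have "x - c \<in> span {u, v} \<longleftrightarrow> x \<in> span {u, v}"
      using cs by (metis diff_add_cancel span_add span_diff)
    moreover have "norm (x - c) = r \<longleftrightarrow> (norm (x - c))\<^sup>2 = r\<^sup>2" using r by (simp add: power2_eq_iff_nonneg)
    moreover have "(norm (x - c))\<^sup>2 = (norm x)\<^sup>2 - 2 * inner x c + 1 + r\<^sup>2"
      using cc by (simp add: power2_norm_eq_inner inner_diff_left inner_diff_right inner_commute)
    ultimately show ?thesis unfolding C circle_point_on_circle[OF uv r] by auto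
  qed
  then show thesis using that[OF cs] by blast
qed

text \<open>
  Two centres differ by a vector of the span of \<open>a\<close> and \<open>b\<close> which is orthogonal to \<open>a\<close> and to \<open>b\<close>.
\<close>

lemma circle_orthogonal_to_sphere_unique:
  assumes ab: "independent {a, b}" "a \<noteq> b"
    and C: "circle_orthogonal_to_sphere C" "a \<in> C" "b \<in> C"
    and D: "circle_orthogonal_to_sphere D" "a \<in> D" "b \<in> D"
  shows "C = D"
proof -
  have *: "\<exists>c \<in> span {a, b}. E = {x \<in> span {a, b}. (norm x)\<^sup>2 + 1 = 2 * inner x c}"
    if E: "circle_orthogonal_to_sphere E" "a \<in> E" "b \<in> E" for E
  proof -
    obtain c u v where "c \<in> span {u, v}" "E = {x \<in> span {u, v}. (norm x)\<^sup>2 + 1 = 2 * inner x c}"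
      using circle_orthogonal_to_sphereE[OF E(1)] .
    moreover from this have "span {u, v} = span {a, b}" using E by (intro span_pair_eq ab) auto
    ultimately show ?thesis by auto
  qed
  obtain c where c: "c \<in> span {a, b}" "C = {x \<in> span {a, b}. (norm x)\<^sup>2 + 1 = 2 * inner x c}"
    using *[OF C] by blast
  obtain d where d: "d \<in> span {a, b}" "D = {x \<in> span {a, b}. (norm x)\<^sup>2 + 1 = 2 * inner x d}"
    using *[OF D] by blast
  have "inner a (c - d) = 0" "inner b (c - d) = 0"
    using C(2,3) D(2,3) c(2) d(2) by (auto simp: inner_diff_right)
  moreover obtain s t where "c - d = s *\<^sub>R a + t *\<^sub>R b"
    using span_diff[OF c(1) d(1)] by (auto simp: mem_span_pair)
  ultimately have "inner (c - d) (c - d) = 0"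
    by (metis add_0 inner_add_left inner_scaleR_left mult_zero_right)
  then show ?thesis using c d by simp
qed

section \<open>The distance of linearly independent points\<close>

text \<open>
  A circle orthogonal to the sphere is parametrised by the half-angle \<open>\<theta>\<close> under which its arc inside
  the ball is seen from its centre \<open>- u / sin \<theta>\<close>. Its radius is \<open>cot \<theta>\<close>, its parameter is the angle measured from
  the direction \<open>u\<close> towards the origin, and its ends are at the angles \<open>\<theta>\<close> and \<open>- \<theta>\<close>.
\<close>

context
  fixes u v :: quat and \<theta> :: real
  assumes uv: "norm u = 1" "norm v = 1" "orthogonal u v"
    and \<theta>: "0 < \<theta>" "\<theta> < pi / 2"
begin

definition orthocircle :: "real \<Rightarrow> quat" where
  "orthocircle = circle_point (- (1 / sin \<theta>) *\<^sub>R u) (cos \<theta> / sin \<theta>) u v"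

lemma sin_cos_pos: "sin \<theta> > 0" "cos \<theta> > 0"
  using \<theta> by (auto intro: sin_gt_zero cos_gt_zero)

lemma radius_pos: "cos \<theta> / sin \<theta> > 0" using sin_cos_pos by simp

lemma orthocircle_coords:
  "orthocircle t = ((cos \<theta> * cos t - 1) / sin \<theta>) *\<^sub>R u + (cos \<theta> * sin t / sin \<theta>) *\<^sub>R v"
  by (simp add: orthocircle_def circle_point_def diff_divide_distrib scaleR_left_diff_distrib)

lemma norm_orthocircle:
  "1 - (norm (orthocircle t))\<^sup>2 = 2 * cos \<theta> * (cos t - cos \<theta>) / (sin \<theta>)\<^sup>2"
proof -
  have "(norm (orthocircle t))\<^sup>2 = ((cos \<theta> * cos t - 1)\<^sup>2 + (cos \<theta>)\<^sup>2 * (sin t)\<^sup>2) / (sin \<theta>)\<^sup>2"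
    unfolding orthocircle_coords norm_sin_cos_combination[OF uv]
    by (simp add: power_divide power_mult_distrib add_divide_distrib)
  also have "(cos \<theta> * cos t - 1)\<^sup>2 + (cos \<theta>)\<^sup>2 * (sin t)\<^sup>2 = (sin \<theta>)\<^sup>2 - 2 * cos \<theta> * (cos t - cos \<theta>)"
    unfolding sin_squared_eq by (simp add: power2_eq_square algebra_simps)
  finally show ?thesis using sin_cos_pos by (simp add: field_simps)
qed

lemma orthocircle_on_sphere: "orthocircle t \<in> sphere 0 1 \<longleftrightarrow> cos t = cos \<theta>"
proof -
  have "orthocircle t \<in> sphere 0 1 \<longleftrightarrow> 1 - (norm (orthocircle t))\<^sup>2 = 0"
    by (simp add: power2_eq_1_iff) (smt (verit) norm_ge_zero)
  then show ?thesis unfolding norm_orthocircle using sin_cos_pos by simp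
qed

lemma orthocircle_ends: "range orthocircle \<inter> sphere 0 1 = {orthocircle \<theta>, orthocircle (- \<theta>)}"
proof
  show "range orthocircle \<inter> sphere 0 1 \<subseteq> {orthocircle \<theta>, orthocircle (- \<theta>)}"
  proof
    fix x assume x: "x \<in> range orthocircle \<inter> sphere 0 1"
    then obtain t where t: "x = orthocircle t" by blast
    with x have "orthocircle t \<in> sphere 0 1" by (metis IntD2)
    then have c: "cos t = cos \<theta>" by (simp only: orthocircle_on_sphere)
    then have "(sin t)\<^sup>2 = (sin \<theta>)\<^sup>2" by (simp add: sin_squared_eq)
    then have "sin t = sin \<theta> \<or> sin t = - sin \<theta>" by (simp add: power2_eq_iff)
    with c show "x \<in> {orthocircle \<theta>, orthocircle (- \<theta>)}" by (auto simp: t orthocircle_coords)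
  qed
  show "{orthocircle \<theta>, orthocircle (- \<theta>)} \<subseteq> range orthocircle \<inter> sphere 0 1"
    using orthocircle_on_sphere[of \<theta>] orthocircle_on_sphere[of "- \<theta>"] by auto
qed

lemma circle_orthogonal_orthocircle: "circle_orthogonal_to_sphere (range orthocircle)"
  unfolding circle_orthogonal_to_sphere_def
proof (intro conjI exI[of _ orthocircle] allI impI)
  show "range orthocircle \<inter> sphere 0 1 \<noteq> {}" unfolding orthocircle_ends by simp
  show "circle_param (range orthocircle) orthocircle"
    unfolding circle_param_def using uv radius_pos orthocircle_def by blast
  fix t w
  assume t: "orthocircle t \<in> sphere 0 1" and w: "orthogonal (orthocircle t) w"
  have c: "cos t = cos \<theta>" using t by (simp only: orthocircle_on_sphere)
  have s2: "sin t * sin t = sin \<theta> * sin \<theta>"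
    using c by (simp add: sin_squared_eq flip: power2_eq_square)
  have cc: "cos \<theta> * cos \<theta> - 1 = - (sin \<theta> * sin \<theta>)"
    by (simp add: sin_squared_eq flip: power2_eq_square)
  have "vector_derivative orthocircle (at t) =
      (cos \<theta> / sin \<theta> * - sin t) *\<^sub>R u + (cos \<theta> / sin \<theta> * cos t) *\<^sub>R v"
    unfolding orthocircle_def by (rule vector_derivative_circle_point)
  \<comment> \<open>at an end the tangent is parallel to the position vector\<close>
  also have "\<dots> = (cos \<theta> * sin t / (sin \<theta>)\<^sup>2) *\<^sub>R orthocircle t"
  proof -
    have "cos \<theta> / sin \<theta> * - sin t = cos \<theta> * sin t / (sin \<theta>)\<^sup>2 * ((cos \<theta> * cos \<theta> - 1) / sin \<theta>)"
      unfolding cc using sin_cos_pos by (simp add: power2_eq_square)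
    moreover have "cos \<theta> / sin \<theta> * cos \<theta> = cos \<theta> * sin t / (sin \<theta>)\<^sup>2 * (cos \<theta> * sin t / sin \<theta>)"
      using s2 sin_cos_pos by (simp add: field_simps power2_eq_square)
    ultimately show ?thesis
      unfolding orthocircle_coords c by (simp only: scaleR_right_distrib scaleR_scaleR)
  qed
  finally show "orthogonal (vector_derivative orthocircle (at t)) w"
    using w by (simp add: orthogonal_def)
qed

lemma orthocircle_dist_to_ends:
  assumes "cos \<theta> < cos t"
  shows "norm (orthocircle t - orthocircle \<theta>) * norm (orthocircle t - orthocircle (- \<theta>)) =
    (1 - (norm (orthocircle t))\<^sup>2) * norm (orthocircle \<theta> - orthocircle (- \<theta>)) / 2"
proof -
  define r where "r = cos \<theta> / sin \<theta>"
  have d: "norm (orthocircle s - orthocircle s') = 2 * r * \<bar>sin ((s - s') / 2)\<bar>" for s s'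
    unfolding orthocircle_def r_def by (rule norm_circle_point_diff[OF uv radius_pos])
  have "2 * sin ((t - \<theta>) / 2) * sin ((t + \<theta>) / 2) = cos (- \<theta>) - cos t"
  proof -
    have "(t - \<theta>) / 2 - (t + \<theta>) / 2 = - \<theta>" "(t - \<theta>) / 2 + (t + \<theta>) / 2 = t"
      by (simp_all add: field_simps)
    then show ?thesis by (simp only: mult.assoc sin_times_sin) simp
  qed
  then have "\<bar>2 * sin ((t - \<theta>) / 2) * sin ((t + \<theta>) / 2)\<bar> = cos t - cos \<theta>"
    using assms by simp
  then have S: "2 * (\<bar>sin ((t - \<theta>) / 2)\<bar> * \<bar>sin ((t + \<theta>) / 2)\<bar>) = cos t - cos \<theta>"
    by (simp add: abs_mult)
  have "norm (orthocircle t - orthocircle \<theta>) * norm (orthocircle t - orthocircle (- \<theta>)) =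
      2 * r\<^sup>2 * (2 * (\<bar>sin ((t - \<theta>) / 2)\<bar> * \<bar>sin ((t + \<theta>) / 2)\<bar>))"
    unfolding d by (simp add: power2_eq_square)
  also have "\<dots> = 2 * r\<^sup>2 * (cos t - cos \<theta>)" using S by simp
  also have "\<dots> = (1 - (norm (orthocircle t))\<^sup>2) * norm (orthocircle \<theta> - orthocircle (- \<theta>)) / 2"
    unfolding d norm_orthocircle r_def using sin_cos_pos by (simp add: field_simps power2_eq_square)
  finally show ?thesis .
qed

text \<open>
  Parameters of a circle are taken from \<open>[0, 2 \<pi>)\<close>. Starting the parametrisation at the end
  \<open>orthocircle (- \<theta>)\<close> keeps the whole arc inside the ball within this interval.
\<close>

lemma cyclically_arranged_orthocircle:
  assumes "- \<theta> < \<alpha>" "\<alpha> < \<beta>" "\<beta> < \<theta>"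
  shows "cyclically_arranged (range orthocircle) (orthocircle \<alpha>) (orthocircle \<beta>)
    (orthocircle \<theta>) (orthocircle (- \<theta>))"
proof -
  define u' v' where "u' = cos \<theta> *\<^sub>R u - sin \<theta> *\<^sub>R v" and "v' = sin \<theta> *\<^sub>R u + cos \<theta> *\<^sub>R v"
  define \<gamma> where "\<gamma> = (\<lambda>t. orthocircle (t - \<theta>))"
  have "inner u u = 1" "inner v v = 1" "inner u v = 0" "inner v u = 0"
    using uv by (auto simp: norm_eq_1 orthogonal_def inner_commute)
  then have "norm u' = 1" "norm v' = 1" "orthogonal u' v'"
    unfolding norm_eq_1 orthogonal_def u'_def v'_def
    by (simp_all add: inner_add_left inner_add_right inner_diff_left inner_diff_right
        flip: power2_eq_square)
  moreover have "\<gamma> = circle_point (- (1 / sin \<theta>) *\<^sub>R u) (cos \<theta> / sin \<theta>) u' v'"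
    unfolding \<gamma>_def orthocircle_def circle_point_def u'_def v'_def
    by (simp add: cos_diff sin_diff algebra_simps)
  moreover have "range orthocircle = range \<gamma>"
  proof -
    have "orthocircle t = \<gamma> (t + \<theta>)" for t by (simp add: \<gamma>_def)
    then have "orthocircle t \<in> range \<gamma>" for t by (metis rangeI)
    moreover have "\<gamma> t \<in> range orthocircle" for t by (simp add: \<gamma>_def)
    ultimately show ?thesis by blast
  qed
  ultimately have par: "circle_param (range orthocircle) \<gamma>"
    unfolding circle_param_def using radius_pos by blast
  have mem: "\<alpha> + \<theta> \<in> {0..<2 * pi}" "\<beta> + \<theta> \<in> {0..<2 * pi}" "2 * \<theta> \<in> {0..<2 * pi}" "0 \<in> {0..<2 * pi}"
    using assms \<theta> by auto
  have ord: "cyclic_order (\<alpha> + \<theta>) (\<beta> + \<theta>) (2 * \<theta>) 0" using assms by (simp add: cyclic_order_def)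
  show ?thesis
    unfolding cyclically_arranged_def
  proof (intro conjI exI[of _ \<gamma>] exI[of _ "{0..<2 * pi}"])
    show "\<exists>t1\<in>{0..<2 * pi}. \<exists>t2\<in>{0..<2 * pi}. \<exists>t3\<in>{0..<2 * pi}. \<exists>t4\<in>{0..<2 * pi}. cyclic_order t1 t2 t3 t4 \<and>
        orthocircle \<alpha> = \<gamma> t1 \<and> orthocircle \<beta> = \<gamma> t2 \<and> orthocircle \<theta> = \<gamma> t3 \<and> orthocircle (- \<theta>) = \<gamma> t4"
      by (rule bexI[OF bexI[OF bexI[OF bexI[OF _ mem(4)] mem(3)] mem(2)] mem(1)])
         (simp add: ord \<gamma>_def)
  qed (use par in auto)
qed

lemma poincare_dist_orthocircle:
  assumes "- \<theta> < \<alpha>" "\<alpha> < \<beta>" "\<beta> < \<theta>"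
    and a: "a = orthocircle \<alpha>" and b: "b = orthocircle \<beta>"
    and ab: "independent {a, b}" "a \<noteq> b" "norm a < 1" "norm b < 1"
  shows "poincare_dist a b = 1 / 2 * arcosh (1 + 2 * hyp_ratio a b)"
proof -
  have line: "noneuclidean_line a b = range orthocircle"
    unfolding noneuclidean_line_def if_not_P[OF ab(1)]
  proof (rule the_equality)
    show *: "circle_orthogonal_to_sphere (range orthocircle) \<and> a \<in> range orthocircle \<and> b \<in> range orthocircle"
      using circle_orthogonal_orthocircle a b by blast
    show "C = range orthocircle" if "circle_orthogonal_to_sphere C \<and> a \<in> C \<and> b \<in> C" for C
      using circle_orthogonal_to_sphere_unique[OF ab(1,2)] that * by blast
  qed
  have cos: "cos \<theta> < cos \<alpha>" "cos \<theta> < cos \<beta>"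
    using assms(1-3) \<theta> cos_monotone_0_pi[of "\<bar>\<alpha>\<bar>" \<theta>] cos_monotone_0_pi[of "\<bar>\<beta>\<bar>" \<theta>] by auto
  show ?thesis
  proof (rule poincare_dist_eqI[OF ab(2-4)])
    show "noneuclidean_line a b \<inter> sphere 0 1 = {orthocircle \<theta>, orthocircle (- \<theta>)}"
      unfolding line by (rule orthocircle_ends)
    show "cyclically_arranged (noneuclidean_line a b) a b (orthocircle \<theta>) (orthocircle (- \<theta>))"
      unfolding line unfolding a b by (rule cyclically_arranged_orthocircle) fact+
  qed (use orthocircle_dist_to_ends cos in \<open>simp_all only: a b\<close>)
qed

end

text \<open>
  The equations for \<open>c\<close> form a linear system whose determinant is the Gram determinant \<open>D\<close> of \<open>a\<close> and \<open>b\<close>;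
  the solution is given by Cramer's rule.
\<close>

lemma orthogonal_center_exists:
  fixes a b :: "'a :: real_inner"
  assumes ab: "independent {a, b}" "a \<noteq> b"
  obtains c where "c \<in> span {a, b}" "2 * inner a c = 1 + (norm a)\<^sup>2" "2 * inner b c = 1 + (norm b)\<^sup>2"
proof -
  define A B G where "A = inner a a" and "B = inner b b" and "G = inner a b"
  define D where "D = A * B - G * G"
  have "D \<noteq> 0"
  proof
    assume "D = 0"
    have "inner (B *\<^sub>R a - G *\<^sub>R b) (B *\<^sub>R a - G *\<^sub>R b) = B * D"
      by (simp add: inner_diff_left inner_diff_right inner_commute D_def A_def B_def G_def algebra_simps)
    then have "B *\<^sub>R a = G *\<^sub>R b" using \<open>D = 0\<close> by simp
    moreover have "B \<noteq> 0" using ab by (auto simp: B_def dependent_zero)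
    ultimately have "a = (G / B) *\<^sub>R b"
      by (metis (no_types) divide_inverse_commute left_inverse scaleR_one scaleR_scaleR)
    then have "a \<in> span {b}" by (metis insertI1 span_base span_scale)
    with ab show False by (simp add: independent_insert)
  qed
  have ip: "inner a a = A" "inner a b = G" "inner b a = G" "inner b b = B"
    by (simp_all add: A_def B_def G_def inner_commute)
  define x y where "x = (1 + A) / 2" and "y = (1 + B) / 2"
  define c where "c = ((B * x - G * y) / D) *\<^sub>R a + ((A * y - G * x) / D) *\<^sub>R b"
  have "inner a c = (A * (B * x - G * y) + G * (A * y - G * x)) / D"
    by (simp add: c_def inner_add_right ip add_divide_distrib mult.commute)
  also have "A * (B * x - G * y) + G * (A * y - G * x) = x * D" by (simp add: D_def algebra_simps)
  finally have 1: "inner a c = x" using \<open>D \<noteq> 0\<close> by simp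
  have "inner b c = (G * (B * x - G * y) + B * (A * y - G * x)) / D"
    by (simp add: c_def inner_add_right ip add_divide_distrib mult.commute)
  also have "G * (B * x - G * y) + B * (A * y - G * x) = y * D" by (simp add: D_def algebra_simps)
  finally have 2: "inner b c = y" using \<open>D \<noteq> 0\<close> by simp
  show thesis
  proof (rule that)
    show "c \<in> span {a, b}" unfolding c_def mem_span_pair by blast
  qed (simp_all add: 1 2 x_def y_def A_def B_def power2_norm_eq_inner)
qed

text \<open>
  The centre \<open>c\<close> lies outside the closed ball, which makes the half-angle \<open>\<theta>\<close> with
  \<open>sin \<theta> = 1 / |c|\<close> available. The frame consists of the direction from \<open>c\<close> to the origin and a vector
  \<open>v\<close> of the plane orthogonal to it, whose sign is chosen so that \<open>a\<close> precedes \<open>b\<close>.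
\<close>

lemma poincare_dist_independent:
  assumes ab: "independent {a, b}" "a \<noteq> b" "norm a < 1" "norm b < 1"
  shows "poincare_dist a b = 1 / 2 * arcosh (1 + 2 * hyp_ratio a b)"
proof -
  obtain c where c: "c \<in> span {a, b}" "2 * inner a c = 1 + (norm a)\<^sup>2" "2 * inner b c = 1 + (norm b)\<^sup>2"
    using orthogonal_center_exists[OF ab(1,2)] .
  have c1: "norm c > 1"
  proof (rule ccontr)
    assume "\<not> norm c > 1"
    then have "norm a * norm c \<le> norm a" by (simp add: mult_left_le)
    then have "1 + (norm a)\<^sup>2 \<le> 2 * norm a" using c(2) norm_cauchy_schwarz[of a c] by linarith
    then have "(1 - norm a)\<^sup>2 \<le> 0" by (simp add: power2_diff)
    then show False using ab(3) by simp
  qed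
  have c0: "c \<noteq> 0" using c1 by auto
  define \<theta> where "\<theta> = arcsin (1 / norm c)"
  have "0 \<le> 1 / norm c" "1 / norm c \<le> 1" using c1 by (auto simp: divide_le_eq_1)
  then have sin: "sin \<theta> = 1 / norm c" unfolding \<theta>_def by (intro sin_arcsin) linarith+
  have "0 < 1 / norm c" "1 / norm c < 1" using c1 by (auto simp: divide_less_eq_1)
  moreover from this have "- 1 \<le> 1 / norm c" by linarith
  ultimately have \<theta>: "0 < \<theta>" "\<theta> < pi / 2"
    using arcsin_less_arcsin[of 0 "1 / norm c"] arcsin_less_arcsin[of "1 / norm c" 1]
    unfolding \<theta>_def by simp_all
  define r where "r = cos \<theta> / sin \<theta>"
  have r: "r > 0" using \<theta> by (auto simp: r_def intro!: divide_pos_pos cos_gt_zero sin_gt_zero)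
  have r2: "r\<^sup>2 = (norm c)\<^sup>2 - 1"
    using c1 c0 by (simp add: r_def power_divide cos_squared_eq sin field_simps)
  define u where "u = - sgn c"
  \<comment> \<open>a combination orthogonal to c; both coefficients are nonzero\<close>
  define w where "w = inner b c *\<^sub>R a - inner a c *\<^sub>R b"
  have ipos: "inner a c > 0" "inner b c > 0"
    using c(2,3) zero_le_power2[of "norm a"] zero_le_power2[of "norm b"] by linarith+
  have w0: "w \<noteq> 0"
  proof
    assume "w = 0"
    then have "inner b c *\<^sub>R a = inner a c *\<^sub>R b" by (simp add: w_def)
    then have "a = (inner a c / inner b c) *\<^sub>R b" using ipos
      by (metis (no_types) divide_inverse_commute left_inverse scaleR_one scaleR_scaleR less_irrefl)
    then have "a \<in> span {b}" by (metis insertI1 span_base span_scale)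
    with ab show False by (simp add: independent_insert)
  qed
  have wc: "inner w c = 0" by (simp add: w_def inner_diff_left)
  define v where "v = sgn w"
  have uv: "norm u = 1" "norm v = 1" "orthogonal u v"
    using c0 w0 wc by (simp_all add: u_def v_def norm_sgn orthogonal_def sgn_div_norm inner_commute)
  have u': "u = (- 1 / norm c) *\<^sub>R c" by (simp add: u_def sgn_div_norm divide_inverse)
  have center: "c = - (1 / sin \<theta>) *\<^sub>R u" using c0 by (simp add: sin u')
  have "w \<in> span {a, b}" unfolding w_def by (intro span_diff span_scale span_base) auto
  then have vs: "v \<in> span {a, b}" by (simp add: v_def sgn_div_norm span_scale)
  have us: "u \<in> span {a, b}" unfolding u' by (intro span_scale c)
  have "span {a, b} = span {u, v}"
  proof (rule span_pair_eq[OF _ _ us vs])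
    show "u \<noteq> v" using uv by (auto simp: orthogonal_def)
    have "pairwise orthogonal {u, v}" using uv(3) by (simp add: pairwise_insert orthogonal_commute)
    then show "independent {u, v}" using uv by (intro pairwise_orthogonal_independent) auto
  qed
  then have abs: "a \<in> span {u, v}" "b \<in> span {u, v}" "c \<in> span {u, v}"
    using c(1) by (auto intro: span_base)
  have angle: "\<exists>t. - \<theta> < t \<and> t < \<theta> \<and> x = orthocircle u v \<theta> t"
    if x: "x \<in> span {u, v}" "2 * inner x c = 1 + (norm x)\<^sup>2" "norm x < 1" for x
  proof -
    obtain s t where st: "x - c = s *\<^sub>R u + t *\<^sub>R v"
      using span_diff[OF x(1) abs(3)] by (auto simp: mem_span_pair)
    have "s\<^sup>2 + t\<^sup>2 = (norm (x - c))\<^sup>2" unfolding st norm_sin_cos_combination[OF uv] ..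
    also have "\<dots> = (norm x)\<^sup>2 - 2 * inner x c + (norm c)\<^sup>2"
      by (simp add: power2_norm_eq_inner inner_diff_left inner_diff_right inner_commute)
    also have "\<dots> = r\<^sup>2" using x(2) r2 by simp
    finally obtain \<phi> where \<phi>: "- pi \<le> \<phi>" "\<phi> \<le> pi" "s = r * cos \<phi>" "t = r * sin \<phi>"
      using polar_coordinates r by metis
    have x\<phi>: "x = orthocircle u v \<theta> \<phi>"
      using st unfolding \<phi> orthocircle_def[OF uv \<theta>] center[symmetric] r_def[symmetric] circle_point_def
      by (simp add: algebra_simps)
    have "1 - (norm x)\<^sup>2 > 0" using x(3) by (simp add: power_less_one_iff)
    then have "cos \<theta> < cos \<phi>"
      unfolding x\<phi> norm_orthocircle[OF uv \<theta>] using sin_cos_pos[OF uv \<theta>] by (simp add: zero_less_divide_iff zero_less_mult_iff)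
    moreover have "\<bar>\<phi>\<bar> \<le> pi" using \<phi>(1,2) by linarith
    ultimately have "\<bar>\<phi>\<bar> < \<theta>"
      using cos_monotone_0_pi_le[of \<theta> "\<bar>\<phi>\<bar>"] \<theta> by (cases "\<bar>\<phi>\<bar> < \<theta>") auto
    then show ?thesis using x\<phi> by (intro exI[of _ \<phi>]) auto
  qed
  obtain \<alpha> where \<alpha>: "- \<theta> < \<alpha>" "\<alpha> < \<theta>" "a = orthocircle u v \<theta> \<alpha>"
    using angle[OF abs(1) c(2) ab(3)] by blast
  obtain \<beta> where \<beta>: "- \<theta> < \<beta>" "\<beta> < \<theta>" "b = orthocircle u v \<theta> \<beta>"
    using angle[OF abs(2) c(3) ab(4)] by blast
  have "\<alpha> \<noteq> \<beta>" using \<alpha> \<beta> ab(2) by auto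
  then consider "\<alpha> < \<beta>" | "\<beta> < \<alpha>" by linarith
  then show ?thesis
  proof cases
    case 1
    then show ?thesis using poincare_dist_orthocircle[OF uv \<theta> \<alpha>(1) 1 \<beta>(2) \<alpha>(3) \<beta>(3)] ab by blast
  next
    case 2
    have uv': "norm u = 1" "norm (- v) = 1" "orthogonal u (- v)" using uv by (simp_all add: orthogonal_def)
    have flip: "orthocircle u v \<theta> t = orthocircle u (- v) \<theta> (- t)" for t
      by (simp add: orthocircle_coords[OF uv \<theta>] orthocircle_coords[OF uv' \<theta>])
    show ?thesis
      using poincare_dist_orthocircle[OF uv' \<theta>, of "- \<alpha>" "- \<beta>" a b] 2 \<alpha> \<beta> ab by (simp add: flip)
  qed
qed

section \<open>The distance of linearly dependent points\<close>

lemma closed_segment_neg: "closed_segment (- p) p = {k *\<^sub>R p | k. \<bar>k\<bar> \<le> 1}"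
  for p :: "'a :: real_vector"
proof -
  have "x \<in> closed_segment (- p) p \<longleftrightarrow> (\<exists>k. \<bar>k\<bar> \<le> 1 \<and> x = k *\<^sub>R p)" for x
  proof
    assume "x \<in> closed_segment (- p) p"
    then obtain u where "0 \<le> u" "u \<le> 1" "x = (1 - u) *\<^sub>R (- p) + u *\<^sub>R p"
      by (auto simp: closed_segment_def)
    then show "\<exists>k. \<bar>k\<bar> \<le> 1 \<and> x = k *\<^sub>R p"
      by (intro exI[of _ "2 * u - 1"]) (auto simp: algebra_simps simp flip: scaleR_2)
  next
    assume "\<exists>k. \<bar>k\<bar> \<le> 1 \<and> x = k *\<^sub>R p"
    then obtain k where k: "\<bar>k\<bar> \<le> 1" "x = k *\<^sub>R p" by blast
    have "(1 - (k + 1) / 2) *\<^sub>R (- p) + ((k + 1) / 2) *\<^sub>R p = (- (1 - (k + 1) / 2) + (k + 1) / 2) *\<^sub>R p"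
      unfolding scaleR_minus_right scaleR_left_distrib scaleR_minus_left ..
    also have "- (1 - (k + 1) / 2) + (k + 1) / 2 = k" by (simp add: field_simps)
    finally have "x = (1 - (k + 1) / 2) *\<^sub>R (- p) + ((k + 1) / 2) *\<^sub>R p" using k by simp
    then show "x \<in> closed_segment (- p) p"
      unfolding closed_segment_def using k by (auto intro!: exI[of _ "(k + 1) / 2"])
  qed
  then show ?thesis by auto
qed

text \<open>
  On a diameter the identity for the ends is \<open>(1 - x) (1 + x) = 1 - x\<^sup>2\<close>. The order \<open>a, b, p, - p\<close> is
  cyclic on the line closed up by \<open>\<infinity>\<close>, where \<open>- p\<close> precedes \<open>a\<close>.
\<close>

lemma poincare_dist_diameter:
  assumes p: "norm p = 1" and st: "s < t" and a: "a = s *\<^sub>R p" "norm a < 1" and b: "b = t *\<^sub>R p" "norm b < 1"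
    and dep: "dependent {a, b}"
  shows "poincare_dist a b = 1 / 2 * arcosh (1 + 2 * hyp_ratio a b)"
proof -
  have s1: "\<bar>s\<bar> < 1" "\<bar>t\<bar> < 1" using a b p by auto
  have p0: "p \<noteq> 0" using p by auto
  have line: "noneuclidean_line a b = closed_segment (- p) p"
    unfolding noneuclidean_line_def if_P[OF dep]
  proof (rule the_equality)
    show "is_diameter (closed_segment (- p) p) \<and> a \<in> closed_segment (- p) p \<and> b \<in> closed_segment (- p) p"
      unfolding is_diameter_def using p a b s1 by (auto simp: closed_segment_neg)
    fix D assume "is_diameter D \<and> a \<in> D \<and> b \<in> D"
    then obtain q where q: "norm q = 1" and D: "D = closed_segment (- q) q" and abD: "a \<in> D" "b \<in> D"
      unfolding is_diameter_def by auto
    have eq: "D = closed_segment (- p) p" if "x *\<^sub>R p \<in> D" "x \<noteq> 0" for x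
    proof -
      obtain k where k: "x *\<^sub>R p = k *\<^sub>R q" using \<open>x *\<^sub>R p \<in> D\<close> by (auto simp: D closed_segment_neg)
      then have "\<bar>x\<bar> = \<bar>k\<bar>" using p q by (metis mult.right_neutral norm_scaleR)
      then have "q = p \<or> q = - p"
        using k \<open>x \<noteq> 0\<close> by (auto simp: abs_eq_iff) (metis minus_equation_iff real_vector.scale_left_imp_eq scaleR_minus_left scaleR_minus_right)
      then show ?thesis by (auto simp: D closed_segment_commute)
    qed
    have "s \<noteq> 0 \<or> t \<noteq> 0" using st by auto
    then show "D = closed_segment (- p) p" using eq abD a b by blast
  qed
  show ?thesis
  proof (rule poincare_dist_eqI[OF _ a(2) b(2)])
    show "a \<noteq> b" using a b st p0 by auto
    show "noneuclidean_line a b \<inter> sphere 0 1 = {p, - p}"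
      unfolding line closed_segment_neg using p
      by (auto simp: abs_eq_iff' intro: exI[of _ "1::real"] exI[of _ "- 1::real"])
    have ord: "cyclic_order s t 1 (- 1)" using st s1 by (auto simp: cyclic_order_def)
    show "cyclically_arranged (noneuclidean_line a b) a b p (- p)"
      unfolding cyclically_arranged_def line
    proof (intro conjI exI[of _ "\<lambda>t. t *\<^sub>R p"] exI[of _ "UNIV :: real set"] disjI2)
      show "{a, b, p, - p} \<subseteq> closed_segment (- p) p"
      proof -
        have "a \<in> closed_segment (- p) p" "b \<in> closed_segment (- p) p"
          using a b s1 by (auto simp: closed_segment_neg)
        then show ?thesis by simp
      qed
      have "closed_segment (- p) p \<subseteq> range (\<lambda>t. t *\<^sub>R p)" by (auto simp: closed_segment_neg)
      then show "\<exists>a u. u \<noteq> 0 \<and> (\<lambda>t. t *\<^sub>R p) = (\<lambda>t. a + t *\<^sub>R u) \<and>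
          closed_segment (- p) p \<subseteq> range (\<lambda>t. t *\<^sub>R p) \<and> (UNIV :: real set) = UNIV"
        using p0 by (intro exI[of _ 0] exI[of _ p]) simp
      show "\<exists>t1\<in>UNIV. \<exists>t2\<in>UNIV. \<exists>t3\<in>UNIV. \<exists>t4\<in>UNIV. cyclic_order t1 t2 t3 t4 \<and>
          a = t1 *\<^sub>R p \<and> b = t2 *\<^sub>R p \<and> p = t3 *\<^sub>R p \<and> - p = t4 *\<^sub>R p"
        by (rule bexI[of _ s], rule bexI[of _ t], rule bexI[of _ 1], rule bexI[of _ "- 1"])
           (use ord a b in simp_all)
    qed
    have "norm (x *\<^sub>R p - p) * norm (x *\<^sub>R p - - p) = (1 - (norm (x *\<^sub>R p))\<^sup>2) * norm (p - - p) / 2" if "\<bar>x\<bar> < 1" for x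
    proof -
      have lin: "x *\<^sub>R p - p = (x - 1) *\<^sub>R p" "x *\<^sub>R p - - p = (x + 1) *\<^sub>R p" "p - - p = 2 *\<^sub>R p"
        by (simp_all add: algebra_simps scaleR_2)
      show ?thesis unfolding lin norm_scaleR using p that by (simp add: power2_eq_square algebra_simps)
    qed
    then show "norm (a - p) * norm (a - - p) = (1 - (norm a)\<^sup>2) * norm (p - - p) / 2"
      "norm (b - p) * norm (b - - p) = (1 - (norm b)\<^sup>2) * norm (p - - p) / 2"
      using s1 a b by blast+
  qed
qed

lemma poincare_dist_dependent:
  assumes ab: "dependent {a, b}" "a \<noteq> b" "norm a < 1" "norm b < 1"
  shows "poincare_dist a b = 1 / 2 * arcosh (1 + 2 * hyp_ratio a b)"
proof -
  have "b = 0 \<or> (\<exists>k. a = k *\<^sub>R b)"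
  proof (rule ccontr)
    assume "\<not> (b = 0 \<or> (\<exists>k. a = k *\<^sub>R b))"
    then have "independent {a, b}" using ab(2) by (auto simp: independent_insert span_singleton)
    with ab(1) show False by contradiction
  qed
  then have "\<exists>q s t. norm q = 1 \<and> a = s *\<^sub>R q \<and> b = t *\<^sub>R q"
  proof
    assume "b = 0"
    then show ?thesis using ab by (intro exI[of _ "sgn a"] exI[of _ "norm a"] exI[of _ 0]) (simp add: norm_sgn sgn_div_norm)
  next
    assume k: "\<exists>k. a = k *\<^sub>R b"
    then obtain k where "a = k *\<^sub>R b" by blast
    moreover from this have "b \<noteq> 0" using ab by auto
    ultimately show ?thesis
      by (intro exI[of _ "sgn b"] exI[of _ "k * norm b"] exI[of _ "norm b"]) (simp add: norm_sgn sgn_div_norm)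
  qed
  then obtain q s t where q: "norm q = 1" "a = s *\<^sub>R q" "b = t *\<^sub>R q" by blast
  then have "s \<noteq> t" using ab by auto
  then consider "s < t" | "- s < - t" by linarith
  then show ?thesis
  proof cases
    case 1
    show ?thesis by (rule poincare_dist_diameter[OF q(1) 1 q(2) ab(3) q(3) ab(4) ab(1)])
  next
    case 2
    show ?thesis by (rule poincare_dist_diameter[OF _ 2 _ ab(3) _ ab(4) ab(1), of "- q"]) (use q in auto)
  qed
qed

section \<open>Invariance of the distance\<close>

lemma poincare_dist_eq_arcosh:
  assumes "a \<in> \<Delta>" "b \<in> \<Delta>"
  shows "\<delta>\<^sub>\<Delta> a b = 1 / 2 * arcosh (1 + 2 * hyp_ratio a b)"
proof (cases "a = b")
  case True
  then show ?thesis by (simp add: poincare_dist_def hyp_ratio_def)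
next
  case False
  then show ?thesis using assms poincare_dist_dependent poincare_dist_independent by auto
qed

theorem proposition1p8:
  shows "(\<forall>f\<in>\<bbbM>. \<forall>a\<in>\<Delta>. \<forall>b\<in>\<Delta>. \<delta>\<^sub>\<Delta> (f a) (f b) = \<delta>\<^sub>\<Delta> a b) \<and>
         (\<forall>a\<in>\<Delta>. \<forall>b\<in>\<Delta>. \<delta>\<^sub>\<Delta> (qconj a) (qconj b) = \<delta>\<^sub>\<Delta> a b)"
proof (intro conjI ballI)
  fix f a b assume f: "f \<in> \<bbbM>" and ab: "a \<in> \<Delta>" "b \<in> \<Delta>"
  have "f ` \<Delta> = \<Delta>" using f by (auto simp: Moebius_group_def)
  then have "f a \<in> \<Delta>" "f b \<in> \<Delta>" using ab by blast+
  then show "\<delta>\<^sub>\<Delta> (f a) (f b) = \<delta>\<^sub>\<Delta> a b"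
    using ab f by (simp add: poincare_dist_eq_arcosh hyp_ratio_Moebius del: mem_ball mem_ball_0)
next
  fix a b assume "a \<in> \<Delta>" "b \<in> \<Delta>"
  then show "\<delta>\<^sub>\<Delta> (qconj a) (qconj b) = \<delta>\<^sub>\<Delta> a b"
    by (simp add: poincare_dist_eq_arcosh hyp_ratio_qconj)
qed

end
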